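(* Let $n,m\ge2$, let $\phi\in\operatorname{Homeo}_+(0,1)$, and suppose $F_n^\phi\le F_m$. Then $F_n^\phi$ is closed in $F_m$ if and only if $\phi$ maps the $n$-adic rationals in $(0,1)$ bijectively onto the $m$-adic rationals in $(0,1)$. Equivalently, $F_n^\phi$ is closed in $F_m$ if and only if $\phi$ has an order-preserving lift $\widetilde\phi:\mathcal C_n\to\mathcal C_m$.
   Context: $F_n$ is the group of increasing piecewise-linear homeomorphisms of $[0,1]$ with finitely many breakpoints, all in $\mathbb Z[1/n]$, and slopes integer powers of $n$; it acts on $(0,1)$. $F_n^\phi$ denotes the conjugate group $\{\phi\circ f\circ\phi^{-1}: f\in F_n\}$ (in the paper's left-to-right notation, $\phi^{-1}F_n\phi$). The $n$-adic rationals in $(0,1)$ are the points of $\mathbb Z[1/n]\cap(0,1)$. $\operatorname{Homeo}_+(0,1)$ is the group of increasing homeomorphisms of $(0,1)$. A subgroup $H\le F_m$ is closed (in $F_m$) if every piecewise-$H$ function in $F_m$ belongs to $H$, where $f\in F_m$ is piecewise-$H$ if there is a finite subdivision $0=a_0<a_1<\dots<a_k=1$ such that on each $[a_{j-1},a_j]$ the function $f$ agrees with some element of $H$. $\mathcal C_n=\{0,\dots,n-1\}^{\mathbb N}$ with the product topology and the lexicographic order, and $\rho_n:\mathcal C_n\to[0,1]$, $\rho_n(\omega_1\omega_2\cdots)=\sum_j\omega_jn^{-j}$. A lift of $\phi$ (extended to $[0,1]$ by fixing the endpoints) is a homeomorphism $\widetilde\phi:\mathcal C_n\to\mathcal C_m$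 with $\rho_m(\widetilde\phi(\omega))=\phi(\rho_n(\omega))$ for all $\omega$. *)

theory Defs
  imports
    "HOL-Analysis.Analysis"
    "HOL-Library.Fun_Lexorder"
    "HOL-Algebra.Group"
begin

text \<open>
  Increasing homeomorphisms of \<open>(0,1)\<close> and of \<open>[0,1]\<close> (the latter fix both endpoints) are
  represented by one and the same total function on the reals, namely their extension by the
  identity. Equality of group elements is then equality of functions, and composition and
  inversion are those of functions on the reals.
\<close>

definition homeo_plus :: "(real \<Rightarrow> real) set" where
  "homeo_plus = {f. (\<exists>g. homeomorphism {0<..<1} {0<..<1} f g) \<and>
                    strict_mono_on {0<..<1} f \<and>
                    (\<forall>x. x \<notin> {0<..<1} \<longrightarrow> f x = x)}"

definition adic_rationals :: "nat \<Rightarrow> real set" where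
  "adic_rationals n = {x. \<exists>(a::int) (k::nat). x = of_int a / of_nat n ^ k}"

definition subdivision :: "(nat \<Rightarrow> real) \<Rightarrow> nat \<Rightarrow> bool" where
  "subdivision a k \<longleftrightarrow> a 0 = 0 \<and> a k = 1 \<and> (\<forall>j<k. a j < a (Suc j))"

text \<open>
  All subdivision points are required to lie in \<open>\<int>[1/n]\<close>; since \<open>0\<close> and \<open>1\<close> do, this says
  exactly that the breakpoints do.
\<close>

definition thompson_F :: "nat \<Rightarrow> (real \<Rightarrow> real) set" where
  "thompson_F n = {f \<in> homeo_plus. \<exists>a k. subdivision a k \<and>
     (\<forall>j\<le>k. a j \<in> adic_rationals n) \<and>
     (\<forall>j<k. \<exists>(s::int) (c::real). \<forall>x\<in>{a j..a (Suc j)}. f x = of_nat n powi s * x + c)}"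

definition thompson_group :: "nat \<Rightarrow> (real \<Rightarrow> real) monoid" where
  "thompson_group n = \<lparr>carrier = thompson_F n, monoid.mult = (\<circ>), one = id\<rparr>"

definition conj_F :: "(real \<Rightarrow> real) \<Rightarrow> nat \<Rightarrow> (real \<Rightarrow> real) set" where
  "conj_F \<phi> n = {\<phi> \<circ> f \<circ> inv_into UNIV \<phi> | f. f \<in> thompson_F n}"

definition piecewise_in :: "(real \<Rightarrow> real) set \<Rightarrow> (real \<Rightarrow> real) \<Rightarrow> bool" where
  "piecewise_in H f \<longleftrightarrow> (\<exists>a k. subdivision a k \<and>
     (\<forall>j<k. \<exists>h\<in>H. \<forall>x\<in>{a j..a (Suc j)}. f x = h x))"

definition closed_in_F :: "nat \<Rightarrow> (real \<Rightarrow> real) set \<Rightarrow> bool" where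
  "closed_in_F m H \<longleftrightarrow> (\<forall>f\<in>thompson_F m. piecewise_in H f \<longrightarrow> f \<in> H)"

definition cantor_space :: "nat \<Rightarrow> (nat \<Rightarrow> nat) topology" where
  "cantor_space n = product_topology (\<lambda>_. discrete_topology {..<n}) UNIV"

text \<open>Digits are indexed from \<open>0\<close>, hence the exponent \<open>Suc j\<close>.\<close>

definition rho :: "nat \<Rightarrow> (nat \<Rightarrow> nat) \<Rightarrow> real" where
  "rho n \<omega> = (\<Sum>j. of_nat (\<omega> j) / of_nat n ^ Suc j)"

text \<open>The extension of \<open>\<phi>\<close> to \<open>[0,1]\<close> is built into the representation.\<close>

definition is_lift :: "nat \<Rightarrow> nat \<Rightarrow> (real \<Rightarrow> real) \<Rightarrow> ((nat \<Rightarrow> nat) \<Rightarrow> nat \<Rightarrow> nat) \<Rightarrow> bool" where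
  "is_lift n m \<phi> \<Phi> \<longleftrightarrow> homeomorphic_map (cantor_space n) (cantor_space m) \<Phi> \<and>
     (\<forall>\<omega>\<in>topspace (cantor_space n). rho m (\<Phi> \<omega>) = \<phi> (rho n \<omega>))"

text \<open>\<open>less_fun\<close> is the strict lexicographic order (not the pointwise one).\<close>

definition lex_preserving :: "nat \<Rightarrow> ((nat \<Rightarrow> nat) \<Rightarrow> nat \<Rightarrow> nat) \<Rightarrow> bool" where
  "lex_preserving n \<Phi> \<longleftrightarrow> monotone_on (topspace (cantor_space n)) less_fun less_fun \<Phi>"

end

theory Submission
  imports Defs
begin

text \<open>
  Gluing two elements of \<open>F\<^sub>n\<^sup>\<phi>\<close> at \<open>\<phi> b\<close> can only create a break of the corresponding map on
  the \<open>F\<^sub>n\<close> side at \<open>b\<close>. If \<open>\<phi>\<close> matches the adic points, a break at a non-adic \<open>b\<close> would force a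
  break in \<open>F\<^sub>m\<close> at a non-adic point, so \<open>F\<^sub>n\<^sup>\<phi>\<close> is closed. Conversely \<open>\<phi>\<close> always maps \<open>n\<close>-adic to
  \<open>m\<close>-adic points, because some element of \<open>F\<^sub>n\<close> has its support start at any given \<open>n\<close>-adic point.
  Suppose \<open>\<phi> b\<close> is \<open>m\<close>-adic but \<open>b\<close> is not \<open>n\<close>-adic. A map \<open>E\<close> of \<open>[0,1)\<close> that is piecewise in \<open>F\<^sub>n\<close>
  with slope \<open>n\<close> is conjugated by \<open>\<phi>\<close> to a map \<open>T\<close> that is piecewise affine with \<open>m\<close>-adic data, and a
  denominator estimate shows that the orbit of \<open>\<phi> b\<close> under \<open>T\<close> is eventually periodic. Hence two
  elements of \<open>F\<^sub>n\<close> agree at \<open>b\<close> but have different slopes \<open>n\<^sup>k\<close>, \<open>n\<^sup>l\<close> there; gluing their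
  conjugates at \<open>\<phi> b\<close> gives an element of \<open>F\<^sub>m\<close> that is piecewise in \<open>F\<^sub>n\<^sup>\<phi>\<close> but not in it.

  For the lifts, the \<open>n\<close>-adic points of \<open>(0,1)\<close> are those with two expansions in base \<open>n\<close>.
\<close>

section \<open>Adic rationals\<close>

lemma adic_rationals_Ints: "x \<in> \<int> \<Longrightarrow> x \<in> adic_rationals n"
  unfolding adic_rationals_def by (elim Ints_cases, simp) (metis div_by_1 power_0)

lemma adic_rationals_iff:
  assumes "n > 0"
  shows "x \<in> adic_rationals n \<longleftrightarrow> (\<exists>k. x * of_nat n ^ k \<in> \<int>)"
proof
  assume "x \<in> adic_rationals n"
  then obtain a k where "x = of_int a / of_nat n ^ k" by (auto simp: adic_rationals_def)
  then have "x * of_nat n ^ k = of_int a" using assms by simp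
  then show "\<exists>k. x * of_nat n ^ k \<in> \<int>" by (metis Ints_of_int)
next
  assume "\<exists>k. x * of_nat n ^ k \<in> \<int>"
  then obtain k a where "x * of_nat n ^ k = of_int a" by (auto elim: Ints_cases)
  then have "x = of_int a / of_nat n ^ k" using assms by (simp add: field_simps)
  then show "x \<in> adic_rationals n" unfolding adic_rationals_def by blast
qed

lemma Ints_mult_power_mono:
  fixes x :: real
  assumes "x * of_nat n ^ k \<in> \<int>" "k \<le> l"
  shows "x * of_nat n ^ l \<in> \<int>"
proof -
  have "x * of_nat n ^ l = (x * of_nat n ^ k) * of_nat n ^ (l - k)"
    using assms(2) by (simp flip: power_add)
  then show ?thesis using assms(1) by (metis Ints_mult Ints_of_nat of_nat_power)
qed

context
  fixes n :: nat assumes n: "n > 0"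
begin

text \<open>Finitely many exponents have a maximum, so denominators can be cleared simultaneously;
  the ring operations below then reduce to those of the integers.\<close>

lemma adic_common_exponent:
  assumes "finite A" "A \<subseteq> adic_rationals n"
  obtains k where "\<And>x. x \<in> A \<Longrightarrow> x * of_nat n ^ k \<in> \<int>"
proof -
  have "\<exists>k. \<forall>x\<in>A. x * of_nat n ^ k \<in> \<int>"
    using assms
  proof (induction rule: finite_induct)
    case (insert x A)
    then obtain k where k: "\<And>x. x \<in> A \<Longrightarrow> x * of_nat n ^ k \<in> \<int>" by blast
    obtain l where l: "x * of_nat n ^ l \<in> \<int>"
      using insert.prems adic_rationals_iff[OF n] by blast
    have "\<forall>y\<in>insert x A. y * of_nat n ^ max k l \<in> \<int>"
      using k l Ints_mult_power_mono[of _ n k "max k l"] Ints_mult_power_mono[of _ n l "max k l"]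
      by auto
    then show ?case by blast
  qed simp
  then show ?thesis using that by blast
qed

lemma adic_add:
  assumes "x \<in> adic_rationals n" "y \<in> adic_rationals n"
  shows "x + y \<in> adic_rationals n"
proof -
  obtain k where k: "\<And>z. z \<in> {x, y} \<Longrightarrow> z * of_nat n ^ k \<in> \<int>"
    by (rule adic_common_exponent[of "{x, y}"]) (use assms in auto)
  have "x * of_nat n ^ k \<in> \<int>" "y * of_nat n ^ k \<in> \<int>" using k by simp_all
  then have "(x + y) * of_nat n ^ k \<in> \<int>" by (simp add: ring_distribs)
  then show ?thesis using adic_rationals_iff[OF n] by blast
qed

lemma adic_mult:
  assumes "x \<in> adic_rationals n" "y \<in> adic_rationals n"
  shows "x * y \<in> adic_rationals n"
proof -
  obtain k where k: "\<And>z. z \<in> {x, y} \<Longrightarrow> z * of_nat n ^ k \<in> \<int>"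
    by (rule adic_common_exponent[of "{x, y}"]) (use assms in auto)
  have "x * of_nat n ^ k \<in> \<int>" "y * of_nat n ^ k \<in> \<int>" using k by simp_all
  then have "(x * of_nat n ^ k) * (y * of_nat n ^ k) \<in> \<int>" by (rule Ints_mult)
  then have "(x * y) * of_nat n ^ (k + k) \<in> \<int>" by (simp add: power_add mult_ac)
  then show ?thesis using adic_rationals_iff[OF n] by blast
qed

lemma adic_uminus: "x \<in> adic_rationals n \<Longrightarrow> - x \<in> adic_rationals n"
  using adic_mult[of "-1" x] by (simp add: adic_rationals_Ints)

lemma adic_diff: "x \<in> adic_rationals n \<Longrightarrow> y \<in> adic_rationals n \<Longrightarrow> x - y \<in> adic_rationals n"
  using adic_add[of x "- y"] adic_uminus[of y] by simp

lemma adic_power_int: "of_nat n powi s \<in> adic_rationals n"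
proof (cases "s \<ge> 0")
  case True
  then show ?thesis by (auto simp: power_int_def intro!: adic_rationals_Ints)
next
  case False
  then have "of_nat n powi s * of_nat n ^ nat (- s) = (1::real)"
    using n by (simp add: power_int_def field_simps)
  then show ?thesis using adic_rationals_iff[OF n] by (metis Ints_1)
qed

lemma adic_divide_power: "x \<in> adic_rationals n \<Longrightarrow> x / of_nat n ^ k \<in> adic_rationals n"
  using adic_mult[of x "of_nat n powi (- int k)"] adic_power_int[of "- int k"]
  by (simp add: power_int_minus divide_inverse)

lemma adic_dense:
  assumes "n \<ge> 2" "x < y"
  obtains z where "z \<in> adic_rationals n" "x < z" "z < y"
proof -
  obtain k where k: "1 / (y - x) < of_nat n ^ k"
    using real_arch_pow[of "of_nat n" "1 / (y - x)"] assms by auto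
  define N :: real where "N = of_nat n ^ k"
  have N: "N > 0" "1 < N * (y - x)"
    using k assms by (auto simp: N_def field_simps)
  \<comment> \<open>The grid of mesh \<open>1 / N\<close> is finer than \<open>y - x\<close>, so its
    first point strictly to the right of x is still below y.\<close>
  define z where "z = of_int (\<lfloor>x * N\<rfloor> + 1) / N"
  have "z \<in> adic_rationals n"
    unfolding z_def N_def adic_rationals_def by blast
  moreover have "x < z"
    unfolding z_def using N(1) by (simp add: field_simps) linarith
  moreover have "z < y"
  proof -
    have "of_int (\<lfloor>x * N\<rfloor> + 1) \<le> x * N + 1" by linarith
    also have "\<dots> < y * N" using N(2) by (simp add: algebra_simps)
    finally show ?thesis unfolding z_def using N(1) by (simp add: field_simps)
  qed
  ultimately show ?thesis using that by blast
qed

end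

section \<open>Increasing homeomorphisms and the groups \<open>F\<^sub>n\<close>\<close>

text \<open>Since the open interval is preserved, extending by the identity keeps the map increasing
  on the whole line. Conversely, a monotone surjection of the line has no jumps, so continuity of
  the map and of its inverse comes for free.\<close>

lemma homeo_plus_iff:
  "f \<in> homeo_plus \<longleftrightarrow> strict_mono f \<and> surj f \<and> (\<forall>x. x \<notin> {0<..<1} \<longrightarrow> f x = x)"
proof
  assume "f \<in> homeo_plus"
  then obtain g where g: "homeomorphism {0<..<1} {0<..<1} f g"
    and mono: "strict_mono_on {0<..<1} f" and id: "\<And>x. x \<notin> {0<..<1} \<Longrightarrow> f x = x"
    unfolding homeo_plus_def by blast
  have img: "f ` {0<..<1} = {0<..<1}"
    using g by (simp add: homeomorphism_def)
  have inside: "0 < f x \<and> f x < 1" if "0 < x" "x < 1" for x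
  proof -
    have "f x \<in> f ` {0<..<1}" using that by simp
    then show ?thesis using img by simp
  qed
  have "strict_mono f"
  proof (rule strict_monoI)
    fix x y :: real
    assume "x < y"
    show "f x < f y"
    proof (cases "x \<in> {0<..<1} \<and> y \<in> {0<..<1}")
      case True
      then show ?thesis using mono \<open>x < y\<close> by (simp add: strict_mono_on_def)
    next
      case False
      then show ?thesis using \<open>x < y\<close> id[of x] id[of y] inside[of x] inside[of y]
        by (cases "x \<in> {0<..<1}"; cases "y \<in> {0<..<1}") auto
    qed
  qed
  moreover have "surj f"
    unfolding surj_def
  proof
    fix y
    show "\<exists>x. y = f x"
    proof (cases "y \<in> {0<..<1}")
      case True
      then have "y \<in> f ` {0<..<1}" using img by simp
      then show ?thesis by blast
    next
      case False
      then have "y = f y" using id by simp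
      then show ?thesis by blast
    qed
  qed
  ultimately show "strict_mono f \<and> surj f \<and> (\<forall>x. x \<notin> {0<..<1} \<longrightarrow> f x = x)"
    using id by blast
next
  assume f: "strict_mono f \<and> surj f \<and> (\<forall>x. x \<notin> {0<..<1} \<longrightarrow> f x = x)"
  then have mono: "strict_mono f" and surj: "surj f" and f01: "f 0 = 0" "f 1 = 1"
    by auto
  have inj: "inj f" using mono by (rule strict_mono_imp_inj_on)
  have inv_mono: "x \<le> y \<Longrightarrow> inv_into UNIV f x \<le> inv_into UNIV f y" for x y
    by (metis mono surj strict_mono_less_eq surj_f_inv_f)
  have in_iff: "f x \<in> {0<..<1} \<longleftrightarrow> x \<in> {0<..<1}" for x
    using strict_mono_less[OF mono, of 0 x] strict_mono_less[OF mono, of x 1] f01 by simp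
  have cont: "continuous_on UNIV f"
    by (rule continuous_onI_mono) (use surj mono in \<open>auto simp: strict_mono_less_eq\<close>)
  have cont_inv: "continuous_on UNIV (inv_into UNIV f)"
    by (rule continuous_onI_mono) (use inj inv_mono in \<open>auto simp: inj_imp_surj_inv\<close>)
  have "homeomorphism {0<..<1} {0<..<1} f (inv_into UNIV f)"
  proof (rule homeomorphismI)
    show "f ` {0<..<1} \<subseteq> {0<..<1}" "inv_into UNIV f ` {0<..<1} \<subseteq> {0<..<1}"
    proof safe
      fix x :: real assume "x \<in> {0<..<1}"
      then have "f x \<in> {0<..<1}" "f (inv_into UNIV f x) \<in> {0<..<1}"
        using in_iff[of x] surj_f_inv_f[OF surj, of x] by simp_all
      then show "f x \<in> {0<..<1}" "inv_into UNIV f x \<in> {0<..<1}"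
        using in_iff by blast+
    qed
  qed (use cont cont_inv inj surj in \<open>auto intro: continuous_on_subset simp: surj_f_inv_f\<close>)
  then show "f \<in> homeo_plus"
    using f unfolding homeo_plus_def by (auto simp: strict_mono_on_def strict_mono_def)
qed

context
  fixes f assumes f: "f \<in> homeo_plus"
begin

lemma homeo_plus_less_iff: "f x < f y \<longleftrightarrow> x < y"
  and homeo_plus_le_iff: "f x \<le> f y \<longleftrightarrow> x \<le> y"
  and homeo_plus_eq_iff: "f x = f y \<longleftrightarrow> x = y"
  using f by (auto simp: homeo_plus_iff strict_mono_less strict_mono_less_eq strict_mono_eq)

lemma homeo_plus_outside: "x \<notin> {0<..<1} \<Longrightarrow> f x = x"
  using f by (auto simp: homeo_plus_iff)

lemma homeo_plus_0_less_iff: "0 < f x \<longleftrightarrow> 0 < x"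
  and homeo_plus_less_1_iff: "f x < 1 \<longleftrightarrow> x < 1"
  and homeo_plus_0_le_iff: "0 \<le> f x \<longleftrightarrow> 0 \<le> x"
  and homeo_plus_le_1_iff: "f x \<le> 1 \<longleftrightarrow> x \<le> 1"
  using homeo_plus_less_iff[of 0 x] homeo_plus_less_iff[of x 1]
    homeo_plus_le_iff[of 0 x] homeo_plus_le_iff[of x 1]
  by (simp_all add: homeo_plus_outside)

lemma homeo_plus_inv_f: "inv_into UNIV f (f x) = x"
  using homeo_plus_eq_iff by (simp add: inv_f_f inj_def)

lemma homeo_plus_f_inv: "f (inv_into UNIV f x) = x"
  using f by (simp add: homeo_plus_iff surj_f_inv_f)

lemma inv_homeo_plus: "inv_into UNIV f \<in> homeo_plus"
  unfolding homeo_plus_iff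
proof (intro conjI allI impI)
  show "strict_mono (inv_into UNIV f)"
    by (rule strict_monoI) (metis homeo_plus_f_inv homeo_plus_less_iff)
  show "surj (inv_into UNIV f)"
    by (metis homeo_plus_inv_f surjI)
  show "inv_into UNIV f x = x" if "x \<notin> {0<..<1}" for x
    using homeo_plus_inv_f[of x] homeo_plus_outside[OF that] by simp
qed

lemma homeo_plus_isCont: "isCont f x"
proof -
  have "continuous_on UNIV f"
    by (rule continuous_onI_mono) (use f in \<open>auto simp: homeo_plus_iff strict_mono_less_eq\<close>)
  then show ?thesis by (simp add: continuous_on_eq_continuous_at)
qed

end

lemma comp_homeo_plus:
  assumes "f \<in> homeo_plus" "g \<in> homeo_plus"
  shows "f \<circ> g \<in> homeo_plus"
proof -
  have "surj (f \<circ> g)" using assms by (intro comp_surj) (auto simp: homeo_plus_iff)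
  then show ?thesis using assms unfolding homeo_plus_iff by (auto simp: strict_mono_def)
qed

lemma homeo_plusI_continuous:
  assumes "strict_mono f" "continuous_on UNIV f" "\<And>x. x \<notin> {0<..<1} \<Longrightarrow> f x = x"
  shows "f \<in> homeo_plus"
  unfolding homeo_plus_iff
proof (intro conjI allI impI)
  show "surj f"
    unfolding surj_def
  proof
    fix y
    show "\<exists>x. y = f x"
    proof (cases "y \<in> {0<..<1}")
      case True
      then have "\<exists>x\<ge>0. x \<le> 1 \<and> f x = y"
        using assms by (intro IVT') (auto intro: continuous_on_subset)
      then show ?thesis by blast
    next
      case False
      then have "y = f y" using assms(3) by simp
      then show ?thesis by blast
    qed
  qed
qed (use assms in auto)

section \<open>Membership in \<open>F\<^sub>n\<close> by affine germs\<close>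

definition locally_affine :: "nat \<Rightarrow> (real \<Rightarrow> real) \<Rightarrow> real \<Rightarrow> bool" where
  "locally_affine n f z \<longleftrightarrow> (\<exists>(s::int) c. \<forall>\<^sub>F x in nhds z. f x = of_nat n powi s * x + c)"

text \<open>Slope and intercept are locally constant on a connected open interval, hence constant;
  continuity carries the formula to the end points.\<close>

lemma affine_on_interval:
  assumes "f \<in> homeo_plus" "x < y" "\<And>z. z \<in> {x<..<y} \<Longrightarrow> locally_affine n f z"
  shows "\<exists>(s::int) c. \<forall>z\<in>{x..y}. f z = of_nat n powi s * z + c"
proof -
  \<comment> \<open>\<open>deriv\<close> turns the local coefficients into functions of the point
    alone: slope first, then intercept.\<close>
  define P where "P z = (deriv f z, f z - deriv f z * z)" for z
  have loc: "\<exists>s c. (\<forall>\<^sub>F u in nhds z. P u = (of_nat n powi s, c)) \<and> P z = (of_nat n powi s, c)"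
    if z: "z \<in> {x<..<y}" for z
  proof -
    obtain s c where "\<forall>\<^sub>F u in nhds z. f u = of_nat n powi s * u + c"
      using assms(3)[OF z] unfolding locally_affine_def by blast
    then have ev: "\<forall>\<^sub>F v in nhds z. \<forall>\<^sub>F u in nhds v. f u = of_nat n powi s * u + c"
      by (simp add: eventually_eventually)
    have "\<forall>\<^sub>F v in nhds z. P v = (of_nat n powi s, c)"
      using ev
    proof eventually_elim
      case (elim v)
      have "((\<lambda>u. of_nat n powi s * u + c) has_real_derivative of_nat n powi s) (at v)"
        by (auto intro!: derivative_eq_intros)
      then have "(f has_real_derivative of_nat n powi s) (at v)"
        using elim DERIV_cong_ev[OF refl elim refl] by blast
      then have "deriv f v = of_nat n powi s" by (rule DERIV_imp_deriv)
      moreover have "f v = of_nat n powi s * v + c"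
        using elim by (rule eventually_nhds_x_imp_x)
      ultimately show ?case by (simp add: P_def)
    qed
    then show ?thesis using eventually_nhds_x_imp_x by blast
  qed
  define w where "w = (x + y) / 2"
  have w: "w \<in> {x<..<y}" using \<open>x < y\<close> by (simp add: w_def)
  then obtain s c where sc: "P w = (of_nat n powi s, c)" using loc by blast
  have const: "P w = P z" if "z \<in> {x<..<y}" for z
  proof (rule connected_local_const[of "{x<..<y}"])
    show "\<forall>a\<in>{x<..<y}. \<forall>\<^sub>F b in at a within {x<..<y}. P a = P b"
    proof
      fix a assume "a \<in> {x<..<y}"
      then have "\<forall>\<^sub>F b in nhds a. P a = P b"
        using loc[of a] by (auto elim: eventually_mono)
      then show "\<forall>\<^sub>F b in at a within {x<..<y}. P a = P b"
        by (simp add: eventually_at_filter eventually_mono)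
    qed
  qed (use w that in auto)
  have aff: "f z = of_nat n powi s * z + c" if "z \<in> {x<..<y}" for z
    using const[OF that] sc by (auto simp: P_def)
  have "f z - of_nat n powi s * z - c = 0" if "z \<in> closure {x<..<y}" for z
    by (rule continuous_constant_on_closure[OF _ _ that])
      (use aff in \<open>auto intro!: continuous_intros continuous_at_imp_continuous_on homeo_plus_isCont[OF assms(1)]\<close>)
  then have "f z = of_nat n powi s * z + c" if "z \<in> {x..y}" for z
    using that \<open>x < y\<close> by (simp add: closure_greaterThanLessThan algebra_simps)
  then show ?thesis by blast
qed

text \<open>This trades an ordered subdivision for an unordered finite set of possible breaks, so
  that gluing and conjugating only require work with germs. Affinity in a two-sided neighbourhood
  says that there is no break at the point.\<close>

lemma thompson_F_iff:
  "f \<in> thompson_F n \<longleftrightarrow> f \<in> homeo_plus \<and>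
     (\<exists>B. finite B \<and> B \<subseteq> adic_rationals n \<and> (\<forall>z\<in>{0<..<1} - B. locally_affine n f z))"
proof
  assume "f \<in> thompson_F n"
  then obtain a k where f: "f \<in> homeo_plus" and a: "subdivision a k" "\<And>j. j \<le> k \<Longrightarrow> a j \<in> adic_rationals n"
    and aff: "\<And>j. j < k \<Longrightarrow> \<exists>(s::int) (c::real). \<forall>x\<in>{a j..a (Suc j)}. f x = of_nat n powi s * x + c"
    unfolding thompson_F_def by blast
  have "locally_affine n f z" if z: "z \<in> {0<..<1} - a ` {..k}" for z
  proof -
    \<comment> \<open>Induction on the index locates the piece containing z; both inequalities are
      strict because z is not a subdivision point.\<close>
    have "\<exists>j<k. a j < z \<and> z < a (Suc j)" if "i \<le> k" "z < a i" for i
      using that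
    proof (induction i)
      case 0
      then show ?case using a(1) z by (simp add: subdivision_def)
    next
      case (Suc i)
      show ?case
      proof (cases "z < a i")
        case True
        then show ?thesis using Suc by simp
      next
        case False
        moreover have "z \<noteq> a i" using z Suc.prems by auto
        ultimately show ?thesis using Suc.prems by (intro exI[of _ i]) auto
      qed
    qed
    from this[of k] obtain j where j: "j < k" "a j < z" "z < a (Suc j)"
      using a(1) z by (auto simp: subdivision_def)
    have near: "\<forall>\<^sub>F x in nhds z. x \<in> {a j<..<a (Suc j)}"
      using j by (intro eventually_nhds_in_open) auto
    obtain s c where "\<And>x. x \<in> {a j..a (Suc j)} \<Longrightarrow> f x = of_nat n powi s * x + c"
      using aff[OF j(1)] by blast
    then have "\<forall>\<^sub>F x in nhds z. f x = of_nat n powi s * x + c"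
      by (intro eventually_mono[OF near]) auto
    then show ?thesis unfolding locally_affine_def by blast
  qed
  then show "f \<in> homeo_plus \<and>
     (\<exists>B. finite B \<and> B \<subseteq> adic_rationals n \<and> (\<forall>z\<in>{0<..<1} - B. locally_affine n f z))"
    using f a(2) by (intro conjI exI[of _ "a ` {..k}"]) auto
next
  assume "f \<in> homeo_plus \<and>
     (\<exists>B. finite B \<and> B \<subseteq> adic_rationals n \<and> (\<forall>z\<in>{0<..<1} - B. locally_affine n f z))"
  then obtain B where f: "f \<in> homeo_plus" and B: "finite B" "B \<subseteq> adic_rationals n"
    and aff: "\<And>z. z \<in> {0<..<1} - B \<Longrightarrow> locally_affine n f z"
    by blast
  \<comment> \<open>Clipping to [0,1] and adding the two end points makes the sorted list of
    exceptional points a subdivision.\<close>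
  define B' where "B' = insert 0 (insert 1 (B \<inter> {0..1}))"
  have B': "finite B'" "B' \<subseteq> adic_rationals n" "B' \<subseteq> {0..1}" "0 \<in> B'" "1 \<in> B'"
    using B by (auto simp: B'_def adic_rationals_Ints)
  define xs where "xs = sorted_list_of_set B'"
  define k where "k = length xs - 1"
  have xs: "set xs = B'" "sorted_wrt (<) xs"
    using B'(1) by (simp_all add: xs_def)
  have len: "length xs = Suc k" using B'(4) xs(1) by (cases xs) (auto simp: k_def)
  have mono: "xs ! i < xs ! j" if "i < j" "j \<le> k" for i j
    using sorted_wrt_nth_less[OF xs(2) that(1)] that(2) len by simp
  have in_B': "xs ! j \<in> B'" if "j \<le> k" for j
    using that len xs(1) nth_mem[of j xs] by simp
  have surj: "\<exists>j\<le>k. xs ! j = b" if "b \<in> B'" for b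
    using that len xs(1) by (metis in_set_conv_nth less_Suc_eq_le)
  have "xs ! 0 = 0"
  proof -
    obtain j where j: "j \<le> k" "xs ! j = 0" using surj[OF B'(4)] by blast
    have "0 \<le> xs ! 0" using in_B'[of 0] B'(3) by auto
    then show ?thesis using mono[of 0 j] j by (cases "j = 0") auto
  qed
  moreover have "xs ! k = 1"
  proof -
    obtain j where j: "j \<le> k" "xs ! j = 1" using surj[OF B'(5)] by blast
    have "xs ! k \<le> 1" using in_B'[of k] B'(3) by auto
    then show ?thesis using mono[of j k] j by (cases "j = k") auto
  qed
  ultimately have sub: "subdivision ((!) xs) k"
    using mono by (simp add: subdivision_def)
  have gap: "z \<notin> B'" if "j < k" "z \<in> {xs ! j<..<xs ! Suc j}" for z j
  proof
    assume "z \<in> B'"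
    then obtain i where i: "i \<le> k" "xs ! i = z" using surj by blast
    have "i \<noteq> j" "i \<noteq> Suc j" using i that by auto
    then consider "i < j" | "Suc j < i" by linarith
    then show False
    proof cases
      case 1 then show False using mono[of i j] i that by simp
    next
      case 2 then show False using mono[of "Suc j" i] i that by simp
    qed
  qed
  have "\<exists>(s::int) c. \<forall>x\<in>{xs ! j..xs ! Suc j}. f x = of_nat n powi s * x + c" if j: "j < k" for j
  proof (rule affine_on_interval[OF f])
    show "xs ! j < xs ! Suc j" using mono j by simp
    fix z assume z: "z \<in> {xs ! j<..<xs ! Suc j}"
    then have "0 < z" "z < 1"
      using in_B'[of j] in_B'[of "Suc j"] j B'(3) by force+
    then show "locally_affine n f z" using gap[OF j z] aff by (auto simp: B'_def)
  qed
  then show "f \<in> thompson_F n"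
    using f sub in_B' B'(2) unfolding thompson_F_def by blast
qed

lemma locally_affineI:
  assumes "a < z" "z < b" "\<And>x. a < x \<Longrightarrow> x < b \<Longrightarrow> f x = of_nat n powi s * x + c"
  shows "locally_affine n f z"
proof -
  have "\<forall>\<^sub>F x in nhds z. x \<in> {a<..<b}"
    using assms by (intro eventually_nhds_in_open) auto
  then have "\<forall>\<^sub>F x in nhds z. f x = of_nat n powi s * x + c"
    by (rule eventually_mono) (use assms(3) in auto)
  then show ?thesis unfolding locally_affine_def by blast
qed

section \<open>Elements of \<open>F\<^sub>n\<close> with prescribed germs\<close>

definition two_ramps :: "real \<Rightarrow> real \<Rightarrow> real \<Rightarrow> real \<Rightarrow> real \<Rightarrow> real \<Rightarrow> real \<Rightarrow> real" where
  "two_ramps p u v q \<alpha> \<beta> x =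
     x + (\<alpha> - 1) * (max p (min x u) - p) + (\<beta> - 1) * (max v (min x q) - v)"

text \<open>Each clamp records the progress of x through its interval, which gives slope \<alpha> on
  [p,u], \<beta> on [v,q] and 1 elsewhere, with evident continuity. \<open>balance\<close> says that
  the two ramps cancel, so the map is the identity again from q on.\<close>

lemma two_ramps_mem_thompson_F:
  fixes s t :: int
  defines "f \<equiv> \<lambda>n p u v q. two_ramps p u v q (of_nat n powi s) (of_nat n powi t)"
  assumes n: "n > 0" and pq: "0 \<le> p" "p < u" "u \<le> v" "v < q" "q \<le> 1"
    and adic: "{p, u, v, q} \<subseteq> adic_rationals n"
    and balance: "(of_nat n powi s - 1) * (u - p) + (of_nat n powi t - 1) * (q - v) = 0"
  shows "f n p u v q \<in> thompson_F n"
proof -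
  let ?f = "f n p u v q" and ?\<alpha> = "of_nat n powi s :: real" and ?\<beta> = "of_nat n powi t :: real"
  have pos: "?\<alpha> > 0" "?\<beta> > 0" using n by simp_all
  have homeo: "?f \<in> homeo_plus"
  proof (rule homeo_plusI_continuous)
    show "strict_mono ?f"
    proof (rule strict_monoI)
      fix x y :: real assume "x < y"
      \<comment> \<open>The increment from x to y splits into the parts d and e spent on the two
        ramps and a remainder of slope 1; all three are nonnegative, are stretched by positive
        factors and cannot vanish together.\<close>
      define d where "d = max p (min y u) - max p (min x u)"
      define e where "e = max v (min y q) - max v (min x q)"
      have de: "d \<ge> 0" "e \<ge> 0" "d + e \<le> y - x"
        using \<open>x < y\<close> pq by (auto simp: d_def e_def max_def min_def)
      have "?f y - ?f x = (y - x - d - e) + ?\<alpha> * d + ?\<beta> * e"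
        by (simp add: f_def two_ramps_def d_def e_def algebra_simps)
      moreover have "\<dots> > 0"
      proof (cases "d + e < y - x")
        case True
        moreover have "?\<alpha> * d \<ge> 0" "?\<beta> * e \<ge> 0" using de pos by simp_all
        ultimately show ?thesis by linarith
      next
        case False
        then have "d > 0 \<or> e > 0" "y - x - d - e = 0" using de \<open>x < y\<close> by linarith+
        moreover have "?\<alpha> * d \<ge> 0" "?\<beta> * e \<ge> 0" using de pos by simp_all
        moreover have "d > 0 \<Longrightarrow> ?\<alpha> * d > 0" "e > 0 \<Longrightarrow> ?\<beta> * e > 0" using pos by simp_all
        ultimately show ?thesis by linarith
      qed
      ultimately show "?f x < ?f y" by linarith
    qed
    show "continuous_on UNIV ?f"
      unfolding f_def two_ramps_def by (intro continuous_intros)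
    show "?f x = x" if "x \<notin> {0<..<1}" for x
    proof (cases "x \<le> 0")
      case True
      then show ?thesis using pq by (simp add: f_def two_ramps_def)
    next
      case False
      then have "min x u = u" "min x q = q" using that pq by auto
      then show ?thesis using balance pq by (simp add: f_def two_ramps_def)
    qed
  qed
  have "locally_affine n ?f z" if z: "z \<in> {0<..<1} - {p, u, v, q}" for z
  proof -
    consider "z < p" | "p < z" "z < u" | "u < z" "z < v" | "v < z" "z < q" | "q < z"
      using z by fastforce
    then show ?thesis
    proof cases
      case 1
      then show ?thesis using pq
        by (intro locally_affineI[of "z - 1" z p _ n 0 0]) (auto simp: f_def two_ramps_def)
    next
      case 2
      then show ?thesis using pq
        by (intro locally_affineI[of p z u _ n s "p - ?\<alpha> * p"])
          (auto simp: f_def two_ramps_def algebra_simps)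
    next
      case 3
      then show ?thesis using pq
        by (intro locally_affineI[of u z v _ n 0 "(?\<alpha> - 1) * (u - p)"])
          (auto simp: f_def two_ramps_def algebra_simps)
    next
      case 4
      then show ?thesis using pq
        by (intro locally_affineI[of v z q _ n t "(?\<alpha> - 1) * (u - p) - (?\<beta> - 1) * v"])
          (auto simp: f_def two_ramps_def algebra_simps)
    next
      case 5
      then show ?thesis using pq balance
        by (intro locally_affineI[of q z "z + 1" _ n 0 0]) (auto simp: f_def two_ramps_def)
    qed
  qed
  then show ?thesis
    using homeo adic unfolding thompson_F_iff by (intro conjI exI[of _ "{p, u, v, q}"]) auto
qed

context
  fixes n :: nat and p w :: real
  assumes n: "n \<ge> 2" and p: "0 \<le> p" and w: "0 < w" and pw: "p + w \<le> 1"
    and adic: "p \<in> adic_rationals n" "w \<in> adic_rationals n"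
begin

private lemma ramp_points_adic:
  "{p, p + w, p + w / of_nat n, p + w - w / of_nat n, p + w / of_nat n ^ 2, p + w - w / of_nat n ^ 2}
     \<subseteq> adic_rationals n"
proof -
  have "w / of_nat n ^ k \<in> adic_rationals n" for k
    using n adic by (intro adic_divide_power) auto
  from this[of 1] this[of 2] show ?thesis
    using adic n by (auto intro!: adic_add adic_diff)
qed

text \<open>For \<open>n \<ge> 2\<close> the two widths are at most \<open>w / 2\<close> and
  \<open>w / 4\<close>, so a long and a short ramp fit into a block of length w without
  overlapping.\<close>

private lemma ramp_points_le: "w / of_nat n + w / of_nat n ^ 2 \<le> w" "0 < w / of_nat n" "0 < w / of_nat n ^ 2"
proof -
  have "w / of_nat n \<le> w / 2" using n w by (intro divide_left_mono) auto
  moreover have "w / of_nat n ^ 2 \<le> w / 4"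
    using n w power_mono[of 2 "real n" 2] by (intro divide_left_mono) auto
  ultimately show "w / of_nat n + w / of_nat n ^ 2 \<le> w" using w by linarith
qed (use n w in auto)

text \<open>Slope n over width \<open>w / n ^ 2\<close> gains \<open>(n - 1) * w / n ^ 2\<close>,
  which is exactly what slope \<open>1 / n\<close> over width \<open>w / n\<close> loses at the
  other end of the block.\<close>

lemma ramp_from_left:
  obtains g where "g \<in> thompson_F n" "\<And>x. x \<le> p \<Longrightarrow> g x = x"
    "\<And>x. x \<in> {p..p + w / of_nat n ^ 2} \<Longrightarrow> g x = of_nat n * x + (p - of_nat n * p)"
proof
  let ?g = "two_ramps p (p + w / of_nat n ^ 2) (p + w - w / of_nat n) (p + w)
    (of_nat n powi 1) (of_nat n powi (-1))"
  show "?g \<in> thompson_F n"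
  proof (rule two_ramps_mem_thompson_F)
    show "(of_nat n powi 1 - 1) * (p + w / of_nat n ^ 2 - p) + (of_nat n powi (-1) - 1) * (p + w - (p + w - w / of_nat n)) = 0"
      using n by (simp add: field_simps power2_eq_square)
  qed (use n p w pw ramp_points_adic ramp_points_le in auto)
  show "?g x = x" if "x \<le> p" for x
    using that ramp_points_le n by (simp add: two_ramps_def)
  show "?g x = of_nat n * x + (p - of_nat n * p)" if "x \<in> {p..p + w / of_nat n ^ 2}" for x
    using that ramp_points_le n by (simp add: two_ramps_def algebra_simps)
qed

text \<open>The mirror image: contraction at the left end of the block pays for expansion about its
  right end.\<close>

lemma ramp_to_right:
  obtains g where "g \<in> thompson_F n"
    "\<And>x. x \<in> {p + w - w / of_nat n ^ 2..p + w} \<Longrightarrow>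
       g x = of_nat n * x + ((p + w) - of_nat n * (p + w))"
proof
  let ?g = "two_ramps p (p + w / of_nat n) (p + w - w / of_nat n ^ 2) (p + w)
    (of_nat n powi (-1)) (of_nat n powi 1)"
  show "?g \<in> thompson_F n"
  proof (rule two_ramps_mem_thompson_F)
    show "(of_nat n powi (-1) - 1) * (p + w / of_nat n - p) + (of_nat n powi 1 - 1) * (p + w - (p + w - w / of_nat n ^ 2)) = 0"
      using n by (simp add: field_simps power2_eq_square)
  qed (use n p w pw ramp_points_adic ramp_points_le in auto)
  show "?g x = of_nat n * x + ((p + w) - of_nat n * (p + w))"
    if "x \<in> {p + w - w / of_nat n ^ 2..p + w}" for x
  proof -
    have "min x (p + w / of_nat n) = p + w / of_nat n" "min x (p + w) = x"
      "max p (p + w / of_nat n) = p + w / of_nat n"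
      "max (p + w - w / of_nat n ^ 2) x = x"
      using that ramp_points_le by auto
    then have "?g x = x + (1 / of_nat n - 1) * (w / of_nat n)
        + (of_nat n - 1) * (x - (p + w - w / of_nat n ^ 2))"
      by (simp add: two_ramps_def inverse_eq_divide)
    also have "\<dots> = of_nat n * x + ((p + w) - of_nat n * (p + w))"
      using n by (simp add: field_simps power2_eq_square)
    finally show ?thesis .
  qed
qed

end

text \<open>
  Expansion about the left end of a cell pushes points to the right and expansion about the right end
  pushes them to the left; using the former for the cells below \<open>1/n\<close> and the latter for the
  others keeps the piecewise expansion inside \<open>[0,1)\<close>.
\<close>

lemma cell_expansion:
  assumes n: "n \<ge> 2" and j: "j < n ^ 3"
  obtains g c where "g \<in> thompson_F n" "c \<in> adic_rationals n"
    "\<And>x. x \<in> {of_nat j / of_nat n ^ 3..of_nat (Suc j) / of_nat n ^ 3} \<Longrightarrow> g x = of_nat n * x + c"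
    "\<And>x. x \<in> {of_nat j / of_nat n ^ 3..<of_nat (Suc j) / of_nat n ^ 3} \<Longrightarrow> g x \<in> {0..<1}"
proof -
  \<comment> \<open>Blocks of length \<open>1 / n\<close> have short ramps of length
    \<open>1 / n ^ 3\<close>, the size of a cell.\<close>
  define w :: real where "w = 1 / of_nat n"
  have n0: "n > 0" using n by simp
  have w: "0 < w" "w \<le> 1 / 2" "w \<in> adic_rationals n"
    using n adic_divide_power[OF n0 adic_rationals_Ints[OF Ints_1], of 1] by (auto simp: w_def field_simps)
  have cell: "w / of_nat n ^ 2 = 1 / of_nat n ^ 3"
    by (simp add: w_def power3_eq_cube power2_eq_square)
  have frac: "of_nat i / of_nat n ^ 3 \<in> adic_rationals n" for i
    by (intro adic_divide_power n0 adic_rationals_Ints) simp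
  show ?thesis
  proof (cases "j < n ^ 2")
    case True
    define p :: real where "p = of_nat j / of_nat n ^ 3"
    have p: "0 \<le> p" "p < w"
    proof -
      have "real j < real n ^ 2" using True by (simp flip: of_nat_power)
      then show "p < w" using n by (simp add: p_def w_def field_simps power3_eq_cube power2_eq_square)
    qed (simp add: p_def)
    have q: "of_nat (Suc j) / of_nat n ^ 3 = p + w / of_nat n ^ 2"
      unfolding cell p_def by (simp add: add_divide_distrib)
    obtain g where g: "g \<in> thompson_F n"
      "\<And>x. x \<in> {p..p + w / of_nat n ^ 2} \<Longrightarrow> g x = of_nat n * x + (p - of_nat n * p)"
      by (rule ramp_from_left[of n p w]) (use n p w frac[of j] in \<open>auto simp: p_def\<close>)
    show ?thesis
    proof (rule that[of g "p - of_nat n * p"])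
      show "p - of_nat n * p \<in> adic_rationals n"
        unfolding p_def by (intro adic_diff adic_mult n0 frac adic_rationals_Ints) simp
      show "g x \<in> {0..<1}" if "x \<in> {of_nat j / of_nat n ^ 3..<of_nat (Suc j) / of_nat n ^ 3}" for x
      proof -
        have x: "p \<le> x" "x < p + w / of_nat n ^ 2" using that q by (auto simp: p_def)
        \<comment> \<open>The stretched cell has length at most w and starts at
          \<open>p < w\<close>, so it ends below \<open>2 * w \<le> 1\<close>.\<close>
        have "of_nat n * (x - p) < of_nat n * (w / of_nat n ^ 2)"
          using x n by (intro mult_strict_left_mono) auto
        also have "\<dots> \<le> w"
          using n w by (simp add: field_simps power2_eq_square)
        finally have "of_nat n * (x - p) < w" .
        moreover have "0 \<le> of_nat n * (x - p)" using x by simp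
        moreover have "g x = p + of_nat n * (x - p)" using x g(2)[of x] by (simp add: algebra_simps)
        ultimately show ?thesis using p w by simp
      qed
    qed (use g q in \<open>auto simp: p_def\<close>)
  next
    case False
    define q :: real where "q = of_nat (Suc j) / of_nat n ^ 3"
    have q: "w < q" "q \<le> 1"
    proof -
      have "real n ^ 2 < real (Suc j)" "real (Suc j) \<le> real n ^ 3"
        using False j by (simp_all flip: of_nat_power)
      then show "w < q" "q \<le> 1"
        using n by (simp_all add: q_def w_def field_simps power3_eq_cube power2_eq_square)
    qed
    have p: "of_nat j / of_nat n ^ 3 = q - w / of_nat n ^ 2"
      unfolding cell q_def by (simp add: add_divide_distrib)
    obtain g where g: "g \<in> thompson_F n"
      "\<And>x. x \<in> {(q - w) + w - w / of_nat n ^ 2..(q - w) + w} \<Longrightarrow>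
        g x = of_nat n * x + (((q - w) + w) - of_nat n * ((q - w) + w))"
      by (rule ramp_to_right[of n "q - w" w])
        (use n q w n0 frac[of "Suc j"] in \<open>auto simp: q_def intro!: adic_diff\<close>)
    show ?thesis
    proof (rule that[of g "q - of_nat n * q"])
      show "q - of_nat n * q \<in> adic_rationals n"
        unfolding q_def by (intro adic_diff adic_mult n0 frac adic_rationals_Ints) simp
      show "g x \<in> {0..<1}" if "x \<in> {of_nat j / of_nat n ^ 3..<of_nat (Suc j) / of_nat n ^ 3}" for x
      proof -
        have x: "q - w / of_nat n ^ 2 \<le> x" "x < q" using that p by (auto simp: q_def)
        \<comment> \<open>The stretched cell reaches at most w to the left of \<open>q > w\<close>,
          so it stays positive.\<close>
        have "of_nat n * (q - x) \<le> of_nat n * (w / of_nat n ^ 2)"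
          using x n by (intro mult_left_mono) auto
        also have "\<dots> \<le> w"
          using n w by (simp add: field_simps power2_eq_square)
        finally have "of_nat n * (q - x) \<le> w" .
        moreover have "0 < of_nat n * (q - x)" using x n by simp
        moreover have "g x = q - of_nat n * (q - x)" using x g(2)[of x] by (simp add: algebra_simps)
        ultimately show ?thesis using q w by simp
      qed
    qed (use g p in \<open>auto simp: q_def\<close>)
  qed
qed

section \<open>Images of adic points under \<phi>\<close>

lemma conj_F_iff:
  "h \<in> conj_F \<phi> n \<longleftrightarrow> (\<exists>g\<in>thompson_F n. h = \<phi> \<circ> g \<circ> inv_into UNIV \<phi>)"
  unfolding conj_F_def by blast

text \<open>
  An element of \<open>F\<^sub>n\<close> that is the identity exactly up to \<open>b\<close> is conjugated to an element of
  \<open>F\<^sub>m\<close> that must break at \<open>\<phi> b\<close>.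
\<close>

lemma adic_image_adic:
  assumes n: "n \<ge> 2" and m: "m > 0" and \<phi>: "\<phi> \<in> homeo_plus"
    and H: "conj_F \<phi> n \<subseteq> thompson_F m"
    and b: "b \<in> adic_rationals n" "0 < b" "b < 1"
  shows "\<phi> b \<in> adic_rationals m"
proof (rule ccontr)
  assume nonadic: "\<phi> b \<notin> adic_rationals m"
  obtain k where k: "1 / (1 - b) < of_nat n ^ k"
    using real_arch_pow[of "of_nat n" "1 / (1 - b)"] n by auto
  \<comment> \<open>An n-adic width small enough for the block starting at b to fit into
    [0,1].\<close>
  define w :: real where "w = 1 / of_nat n ^ k"
  have w: "0 < w" "b + w \<le> 1" "w \<in> adic_rationals n"
    using n k b adic_divide_power[of n 1 k] by (auto simp: w_def field_simps adic_rationals_Ints)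
  obtain g where g: "g \<in> thompson_F n" "\<And>x. x \<le> b \<Longrightarrow> g x = x"
    "\<And>x. x \<in> {b..b + w / of_nat n ^ 2} \<Longrightarrow> g x = of_nat n * x + (b - of_nat n * b)"
    by (rule ramp_from_left[of n b w]) (use n b w in auto)
  define h where "h = \<phi> \<circ> g \<circ> inv_into UNIV \<phi>"
  have h_\<phi>: "h (\<phi> x) = \<phi> (g x)" for x
    by (simp add: h_def homeo_plus_inv_f[OF \<phi>])
  have "h \<in> thompson_F m" using H g(1) unfolding h_def conj_F_iff[symmetric] conj_F_def by blast
  then have "locally_affine m h (\<phi> b)"
    using nonadic b \<phi> unfolding thompson_F_iff
    by (auto simp: homeo_plus_0_less_iff homeo_plus_less_1_iff)
  then obtain s c where "\<forall>\<^sub>F y in nhds (\<phi> b). h y = of_nat m powi s * y + c"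
    unfolding locally_affine_def by blast
  then obtain e where e: "e > 0" "\<And>y. dist y (\<phi> b) < e \<Longrightarrow> h y = of_nat m powi s * y + c"
    unfolding eventually_nhds_metric by blast
  have left: "h y = y" if "y \<le> \<phi> b" for y
  proof -
    have "inv_into UNIV \<phi> y \<le> b"
      using that homeo_plus_le_iff[OF \<phi>, of "inv_into UNIV \<phi> y" b] by (simp add: homeo_plus_f_inv[OF \<phi>])
    then have "h y = \<phi> (inv_into UNIV \<phi> y)" by (simp add: h_def g(2))
    then show ?thesis by (simp add: homeo_plus_f_inv[OF \<phi>])
  qed
  \<comment> \<open>Two points on the left, where h is the identity, determine the affine germ;
    hence h is the identity on the right as well.\<close>
  have "of_nat m powi s * \<phi> b + c = \<phi> b"
    "of_nat m powi s * (\<phi> b - e / 2) + c = \<phi> b - e / 2"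
    using e(2)[of "\<phi> b"] e(2)[of "\<phi> b - e / 2"] left[of "\<phi> b"] left[of "\<phi> b - e / 2"] e(1)
    by (auto simp: dist_real_def)
  then have "of_nat m powi s * (e / 2) = e / 2" "of_nat m powi s * \<phi> b + c = \<phi> b"
    unfolding right_diff_distrib by linarith+
  then have "of_nat m powi s = (1::real)" "c = 0" using e(1) by simp_all
  then have id: "h y = y" if "dist y (\<phi> b) < e" for y using e(2)[OF that] by simp
  \<comment> \<open>The point y is close enough to \<open>\<phi> b\<close> to be fixed by h, and low
    enough for its preimage to lie on the steep ramp, where g moves every point except b.\<close>
  define y where "y = min (\<phi> b + e / 2) (\<phi> (b + w / of_nat n ^ 2))"
  define x where "x = inv_into UNIV \<phi> y"
  have y: "y = \<phi> x" by (simp add: x_def homeo_plus_f_inv[OF \<phi>])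
  have "\<phi> b < y" "y \<le> \<phi> (b + w / of_nat n ^ 2)"
    using e(1) w n by (auto simp: y_def homeo_plus_less_iff[OF \<phi>])
  then have x: "b < x" "x \<le> b + w / of_nat n ^ 2"
    by (simp_all add: y homeo_plus_less_iff[OF \<phi>] homeo_plus_le_iff[OF \<phi>])
  have "dist y (\<phi> b) < e" using \<open>\<phi> b < y\<close> e(1) by (auto simp: y_def dist_real_def)
  then have "g x = x" using id h_\<phi>[of x] y by (simp add: homeo_plus_eq_iff[OF \<phi>])
  then have "(of_nat n - 1) * (x - b) = 0" using g(3)[of x] x by (simp add: algebra_simps)
  then show False using x n by simp
qed

section \<open>Orbits of adic points under piecewise affine maps\<close>

text \<open>The scaled difference is a positive integer, hence at least 1. The exponent is an
  integer because logarithmic slopes get subtracted from it later.\<close>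

lemma integral_gap:
  fixes u v :: real
  assumes "m > 0" "u * of_nat m powi V \<in> \<int>" "v * of_nat m powi V \<in> \<int>" "u < v"
  shows "of_nat m powi (- V) \<le> v - u"
proof -
  have pos: "(of_nat m powi V :: real) > 0" using assms(1) by simp
  have "(v - u) * of_nat m powi V \<in> \<int>"
    using Ints_diff[OF assms(3,2)] by (simp add: left_diff_distrib)
  then obtain i where i: "(v - u) * of_nat m powi V = of_int i" by (auto elim: Ints_cases)
  moreover have "(v - u) * of_nat m powi V > 0" using assms(4) pos by simp
  ultimately have "1 \<le> (v - u) * of_nat m powi V" unfolding i by simp
  then show ?thesis using pos by (simp add: power_int_minus inverse_eq_divide pos_divide_le_eq)
qed

lemma finite_integral_multiples:
  assumes "(C::real) > 0"
  shows "finite {y. 0 \<le> y \<and> y < 1 \<and> y * C \<in> \<int>}"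
proof (rule finite_subset)
  show "{y. 0 \<le> y \<and> y < 1 \<and> y * C \<in> \<int>} \<subseteq> (\<lambda>i. of_int i / C) ` {0..\<lceil>C\<rceil>}"
  proof
    fix y assume "y \<in> {y. 0 \<le> y \<and> y < 1 \<and> y * C \<in> \<int>}"
    then obtain i where y: "0 \<le> y" "y < 1" "y * C = of_int i" by (auto elim: Ints_cases)
    have "of_int i < C" using y assms mult_strict_right_mono[of y 1 C] by simp
    then have "i \<le> \<lceil>C\<rceil>" by linarith
    moreover have "0 \<le> i" 
    proof -
      have "0 \<le> y * C" by (rule mult_nonneg_nonneg) (use y assms in auto)
      then show ?thesis unfolding y(3) by simp
    qed
    moreover have "y = of_int i / C" using y assms by (simp add: field_simps)
    ultimately show "y \<in> (\<lambda>i. of_int i / C) ` {0..\<lceil>C\<rceil>}" by auto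
  qed
qed simp

text \<open>
  Let \<open>S k\<close> be the logarithmic slope of \<open>T ^^ k\<close> to the right of \<open>a\<close>. The point \<open>T\<^sup>k a\<close> has
  denominator at most \<open>m\<close> to the power \<open>max V0 (C + max\<^sub>i\<^sub>\<le>\<^sub>k S i) - S k\<close>. If \<open>S\<close> were bounded
  above, all breaks would keep such a distance from the orbit that every iterate is affine on one
  and the same interval to the right of \<open>a\<close>, against expansiveness. So \<open>S\<close> has infinitely many
  record values, and at these times the orbit meets the finite set of points with denominator \<open>m\<^sup>C\<close>.
\<close>

lemma adic_orbit_preperiodic:
  fixes T :: "real \<Rightarrow> real" and t :: "real \<Rightarrow> int"
  assumes m: "m \<ge> 2" and B: "finite B" "B \<subseteq> adic_rationals m" "0 \<in> B" "1 \<in> B"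
    and affine: "\<And>\<beta> y. \<beta> \<in> B \<Longrightarrow> 0 \<le> \<beta> \<Longrightarrow> \<beta> \<le> y \<Longrightarrow> y < 1 \<Longrightarrow>
      \<forall>\<gamma>\<in>B. \<not> (\<beta> < \<gamma> \<and> \<gamma> \<le> y) \<Longrightarrow> T y = of_nat m powi t \<beta> * y + c \<beta>"
    and offset: "\<And>\<beta>. \<beta> \<in> B \<Longrightarrow> 0 \<le> \<beta> \<Longrightarrow> \<beta> < 1 \<Longrightarrow> c \<beta> \<in> adic_rationals m"
    and maps: "\<And>y. y \<in> {0..<1} \<Longrightarrow> T y \<in> {0..<1}"
    and expansive: "\<And>x y. 0 \<le> x \<Longrightarrow> x < y \<Longrightarrow> y < 1 \<Longrightarrow>
      \<exists>k. \<exists>\<beta>\<in>B. (T ^^ k) x < \<beta> \<and> \<beta> \<le> (T ^^ k) y"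
    and a: "a \<in> adic_rationals m" "a \<in> {0..<1}"
  shows "\<exists>k l. k < l \<and> (T ^^ k) a = (T ^^ l) a"
proof -
  have m0: "m > 0" "real m \<noteq> 0" using m by auto
  \<comment> \<open>\<open>lev V y\<close> makes y an integral multiple of m to the power
    \<open>- V\<close>; larger V means a weaker condition.\<close>
  define lev where "lev V y \<longleftrightarrow> y * of_nat m powi V \<in> \<int>" for V :: int and y :: real
  have lev_mono: "lev V' y" if lev: "lev V y" and le: "V \<le> V'" for V V' y
  proof -
    have "y * of_nat m powi V' = (y * of_nat m powi V) * of_nat m powi (V' - V)"
      using m0 by (simp flip: power_int_add)
    also have "of_nat m powi (V' - V) = (of_nat (m ^ nat (V' - V)) :: real)"
      using le by (simp add: power_int_def)
    finally show ?thesis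
      unfolding lev_def by (metis Ints_mult Ints_of_nat lev lev_def)
  qed
  obtain C0 where C0: "\<And>y. y \<in> B \<union> c ` (B \<inter> {0..<1}) \<Longrightarrow> y * of_nat m ^ C0 \<in> \<int>"
    by (rule adic_common_exponent[of m "B \<union> c ` (B \<inter> {0..<1})"]) (use m0 B offset in auto)
  define C where "C = int C0"
  have lev_B: "lev C \<beta>" if "\<beta> \<in> B" for \<beta>
    using C0 that by (simp add: lev_def C_def)
  have lev_c: "lev C (c \<beta>)" if "\<beta> \<in> B" "0 \<le> \<beta>" "\<beta> < 1" for \<beta>
    using C0[of "c \<beta>"] that by (simp add: lev_def C_def)
  \<comment> \<open>The last break at or before y selects the affine branch of T that is valid to
    the right of y.\<close>
  define pb where "pb y = Max {\<beta> \<in> B. 0 \<le> \<beta> \<and> \<beta> \<le> y}" for y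
  have pb: "pb y \<in> B" "0 \<le> pb y" "pb y \<le> y" "\<forall>\<gamma>\<in>B. \<not> (pb y < \<gamma> \<and> \<gamma> \<le> y)" if "0 \<le> y" for y
  proof -
    let ?P = "{\<beta> \<in> B. 0 \<le> \<beta> \<and> \<beta> \<le> y}"
    have fin: "finite ?P" and ne: "?P \<noteq> {}" using B that by auto
    from Max_in[OF fin ne] show *: "pb y \<in> B" "0 \<le> pb y" "pb y \<le> y" by (auto simp: pb_def)
    show "\<forall>\<gamma>\<in>B. \<not> (pb y < \<gamma> \<and> \<gamma> \<le> y)"
    proof (intro ballI notI)
      fix \<gamma> assume "\<gamma> \<in> B" "pb y < \<gamma> \<and> \<gamma> \<le> y"
      then have "\<gamma> \<le> pb y" using Max_ge[OF fin, of \<gamma>] *(2) by (auto simp: pb_def)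
      then show False using \<open>pb y < \<gamma> \<and> \<gamma> \<le> y\<close> by simp
    qed
  qed
  define \<sigma> where "\<sigma> y = t (pb y)" for y
  have T_eq: "T y = of_nat m powi \<sigma> x * y + c (pb x)"
    if "0 \<le> x" "x \<le> y" "y < 1" "\<forall>\<gamma>\<in>B. \<not> (x < \<gamma> \<and> \<gamma> \<le> y)" for x y
    unfolding \<sigma>_def
  proof (rule affine)
    show "\<forall>\<gamma>\<in>B. \<not> (pb x < \<gamma> \<and> \<gamma> \<le> y)"
      using pb(4)[OF that(1)] that(4) by (meson linorder_not_le)
  qed (use pb[OF that(1)] that in auto)
  \<comment> \<open>Multiplying by m to the power \<open>\<sigma> y\<close> lowers the level by
    \<open>\<sigma> y\<close>, and adding the offset raises it to C at worst.\<close>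
  have lev_T: "lev (max (V - \<sigma> y) C) (T y)" if y: "lev V y" "y \<in> {0..<1}" for V y
  proof -
    have "lev (V - \<sigma> y) (of_nat m powi \<sigma> y * y)"
      using y(1) m0 by (simp add: lev_def power_int_diff)
    moreover have "lev C (c (pb y))" using lev_c pb(1-3)[of y] y(2) by simp
    ultimately have "lev (max (V - \<sigma> y) C) (of_nat m powi \<sigma> y * y)" "lev (max (V - \<sigma> y) C) (c (pb y))"
      by (auto intro: lev_mono)
    then show ?thesis
      using y(2) by (subst T_eq[of y y]) (auto simp: lev_def distrib_right)
  qed
  define x where "x k = (T ^^ k) a" for k
  have x_Suc: "x (Suc k) = T (x k)" for k by (simp add: x_def)
  have x01: "x k \<in> {0..<1}" for k
  proof (induction k)
    case 0 show ?case using a(2) by (simp add: x_def)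
  next
    case (Suc k) then show ?case using maps unfolding x_Suc by blast
  qed
  define S where "S k = (\<Sum>i<k. \<sigma> (x i))" for k
  have S_Suc: "S (Suc k) = S k + \<sigma> (x k)" for k by (simp add: S_def)
  obtain V0 where V0: "lev (int V0) a"
    using a(1) unfolding adic_rationals_iff[OF m0(1)] lev_def by auto
  \<comment> \<open>M dominates every \<open>S i + C\<close> seen so far, so the floor C in
    \<open>lev_T\<close> never exceeds the level \<open>M - S k\<close> and the levels simply
    accumulate.\<close>
  have lev_x: "lev (M - S k) (x k)" if "int V0 \<le> M" "\<And>i. i \<le> k \<Longrightarrow> S i + C \<le> M" for M k
    using that
  proof (induction k)
    case 0
    then show ?case using V0 lev_mono by (simp add: S_def x_def)
  next
    case (Suc k)
    have "lev (max (M - S k - \<sigma> (x k)) C) (x (Suc k))"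
      unfolding x_Suc using Suc x01 by (intro lev_T) auto
    moreover have "max (M - S k - \<sigma> (x k)) C = M - S (Suc k)"
      using Suc.prems(2)[of "Suc k"] by (simp add: S_Suc)
    ultimately show ?case by simp
  qed
  have unbounded: "\<exists>k. M < S k" for M
  proof (rule ccontr)
    assume "\<not> (\<exists>k. M < S k)"
    then have bound: "S k \<le> M" for k by (meson not_le)
    \<comment> \<open>As \<open>S k \<le> M\<close>, the level \<open>W - S k\<close> is at least C;
      it therefore covers the breaks as well as the orbit point \<open>x k\<close>.\<close>
    define W where "W = max (int V0) (M + C)"
    have lev_W: "lev (W - S k) (x k)" for k
      using bound by (intro lev_x) (auto simp: W_def le_max_iff_disj)
    \<comment> \<open>Distinct points of level \<open>W - S k\<close> are at least m to the power
      \<open>S k - W\<close> apart. Stretched by m to the power \<open>S k\<close>, the displacement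
      R covers only half of that.\<close>
    define R :: real where "R = of_nat m powi (- W) / 2"
    have R: "R > 0" using m by (simp add: R_def)
    have gap: "x k + of_nat m powi S k * R < \<gamma>" if \<gamma>: "\<gamma> \<in> B" "x k < \<gamma>" for k \<gamma>
    proof -
      have "lev (W - S k) \<gamma>"
        using lev_mono[OF lev_B[OF \<gamma>(1)], of "W - S k"] bound[of k] by (simp add: W_def)
      then have "of_nat m powi (S k - W) \<le> \<gamma> - x k"
        using integral_gap[of m "x k" "W - S k" \<gamma>] lev_W[of k] \<gamma>(2) m0 by (simp add: lev_def)
      moreover have "of_nat m powi (S k - W) = 2 * (of_nat m powi S k * R)"
        using m0 by (simp add: R_def power_int_diff power_int_minus field_simps)
      moreover have "of_nat m powi S k * R > 0" using R m by simp
      ultimately show ?thesis by linarith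
    qed
    \<comment> \<open>No break separates the orbits of a and \<open>a + R\<close>, so both always
      use the same branch and their distance only gets multiplied by its slope.\<close>
    have stays: "(T ^^ k) (a + R) = x k + of_nat m powi S k * R" for k
    proof (induction k)
      case 0 show ?case by (simp add: x_def S_def)
    next
      case (Suc k)
      let ?z = "x k + of_nat m powi S k * R"
      have nonneg: "of_nat m powi S k * R \<ge> 0" using R by simp
      have "?z < 1" using gap[OF B(4)] x01[of k] by simp
      have none: "\<forall>\<gamma>\<in>B. \<not> (x k < \<gamma> \<and> \<gamma> \<le> ?z)" using gap by force
      have "T ?z = of_nat m powi \<sigma> (x k) * ?z + c (pb (x k))"
        using T_eq[of "x k" ?z] none \<open>?z < 1\<close> nonneg x01[of k] by simp
      moreover have "T (x k) = of_nat m powi \<sigma> (x k) * x k + c (pb (x k))"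
        using T_eq[of "x k" "x k"] x01[of k] by auto
      ultimately have "T ?z = x (Suc k) + of_nat m powi (S k + \<sigma> (x k)) * R"
        using m0 by (simp add: x_Suc power_int_add algebra_simps)
      then show ?case using Suc by (simp add: S_Suc)
    qed
    have "a + R < 1" using gap[OF B(4), of 0] a(2) by (simp add: x_def S_def)
    then obtain k \<beta> where "\<beta> \<in> B" "(T ^^ k) a < \<beta>" "\<beta> \<le> (T ^^ k) (a + R)"
      using expansive[of a "a + R"] a(2) R by auto
    then show False using gap[of \<beta> k] stays[of k] by (simp add: x_def)
  qed
  have low: "\<exists>k. M < S k \<and> lev C (x k)" for M
  proof -
    \<comment> \<open>At the first time k when S exceeds M', all earlier sums are smaller. Since M'
      also dominates \<open>V0\<close>, \<open>lev_x\<close> applies with bound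
      \<open>C + S k\<close> and leaves exactly level C.\<close>
    define M' where "M' = max M (int V0)"
    define k where "k = (LEAST k. M' < S k)"
    have k: "M' < S k" unfolding k_def using unbounded by (rule LeastI_ex)
    have before: "S i \<le> M'" if "i < k" for i
      using not_less_Least[of i "\<lambda>k. M' < S k"] that by (simp add: k_def)
    have "lev (C + S k - S k) (x k)"
    proof (rule lev_x)
      show "int V0 \<le> C + S k" using k by (simp add: M'_def C_def)
      show "S i + C \<le> C + S k" if "i \<le> k" for i
        using before[of i] k that by (cases "i = k") auto
    qed
    then show ?thesis using k by (auto simp: M'_def)
  qed
  \<comment> \<open>S is unbounded on K, so K is infinite, whereas the orbit points at times in K
    form a finite set; two of them coincide.\<close>
  define K where "K = {k. lev C (x k)}"
  have "infinite K"
  proof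
    assume "finite K"
    then have "bdd_above (S ` K)" by simp
    then obtain M where M: "\<And>k. k \<in> K \<Longrightarrow> S k \<le> M" unfolding bdd_above_def by auto
    obtain k where "M < S k" "k \<in> K" using low[of M] by (auto simp: K_def)
    then show False using M[of k] by simp
  qed
  moreover have "finite (x ` K)"
  proof (rule finite_subset)
    show "x ` K \<subseteq> {y. 0 \<le> y \<and> y < 1 \<and> y * of_nat m powi C \<in> \<int>}"
      using x01 by (auto simp: K_def lev_def)
  qed (use m in \<open>simp add: finite_integral_multiples\<close>)
  ultimately have "\<not> inj_on x K" using finite_imageD by blast
  then obtain k l where "k \<noteq> l" "x k = x l" unfolding inj_on_def by blast
  then show ?thesis unfolding x_def by (metis nat_neq_iff)
qed

section \<open>Closedness and adic points\<close>

lemma conjugate_mem_thompson_F: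
  assumes "conj_F \<phi> n \<subseteq> thompson_F m" "g \<in> thompson_F n"
  shows "\<phi> \<circ> g \<circ> inv_into UNIV \<phi> \<in> thompson_F m"
  using assms unfolding conj_F_def by blast

text \<open>Closure under composition is inherited from the subgroup hypothesis by cancelling the
  conjugation with \<phi>.\<close>

lemma thompson_F_comp:
  assumes \<phi>: "\<phi> \<in> homeo_plus" and sub: "subgroup (conj_F \<phi> n) (thompson_group m)"
    and g: "g \<in> thompson_F n" "g' \<in> thompson_F n"
  shows "g \<circ> g' \<in> thompson_F n"
proof -
  let ?\<psi> = "inv_into UNIV \<phi>"
  have "(\<phi> \<circ> g \<circ> ?\<psi>) \<otimes>\<^bsub>thompson_group m\<^esub> (\<phi> \<circ> g' \<circ> ?\<psi>) \<in> conj_F \<phi> n"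
    by (rule subgroup.m_closed[OF sub]) (use g in \<open>auto simp: conj_F_def\<close>)
  then obtain k where k: "k \<in> thompson_F n"
    and eq: "(\<phi> \<circ> g \<circ> ?\<psi>) \<circ> (\<phi> \<circ> g' \<circ> ?\<psi>) = \<phi> \<circ> k \<circ> ?\<psi>"
    unfolding conj_F_iff by (auto simp: thompson_group_def)
  have "g (g' x) = k x" for x
    using fun_cong[OF eq, of "\<phi> x"] by (simp add: homeo_plus_inv_f[OF \<phi>] homeo_plus_eq_iff[OF \<phi>])
  then have "g \<circ> g' = k" by auto
  then show ?thesis using k by simp
qed

text \<open>Agreement on one side of z already gives two distinct points common to the two lines,
  namely z and a point of the segment close to it.\<close>

lemma affine_germs_agree:
  fixes z a b :: real
  assumes f: "\<forall>\<^sub>F x in nhds z. f x = A * x + c"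
    and l: "\<forall>\<^sub>F x in nhds z. l x = A' * x + c'"
    and "a \<noteq> z" "\<And>x. x \<in> closed_segment a z \<Longrightarrow> f x = l x"
  shows "A = A'" "c = c'"
proof -
  obtain e where e: "e > 0" "\<And>x. dist x z < e \<Longrightarrow> f x = A * x + c \<and> l x = A' * x + c'"
    using eventually_conj[OF f l] unfolding eventually_nhds_metric by blast
  \<comment> \<open>The cap 1 keeps x in the segment; the other bound brings it within
    \<open>e / 2\<close> of z.\<close>
  define r where "r = min 1 (e / (2 * \<bar>a - z\<bar>))"
  define x where "x = z + r * (a - z)"
  have r: "0 < r" "r \<le> 1" using e(1) \<open>a \<noteq> z\<close> by (simp_all add: r_def)
  have "x \<in> closed_segment a z" unfolding in_segment
    using r by (intro exI[of _ "1 - r"]) (auto simp: x_def algebra_simps)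
  then have eqs: "f x = l x" "f z = l z" using assms(4)[of x] assms(4)[of z] by auto
  have "\<bar>x - z\<bar> = r * \<bar>a - z\<bar>" using r by (simp add: x_def abs_mult)
  also have "\<dots> \<le> e / (2 * \<bar>a - z\<bar>) * \<bar>a - z\<bar>"
    by (intro mult_right_mono) (auto simp: r_def)
  also have "\<dots> = e / 2" using \<open>a \<noteq> z\<close> by simp
  finally have "dist x z < e" using e(1) by (simp add: dist_real_def)
  then have 1: "A * x + c = A' * x + c'" "A * z + c = A' * z + c'"
    using e(2)[of x] e(2)[of z] e(1) eqs by auto
  then have "(A - A') * (x - z) = 0" by (simp add: algebra_simps)
  moreover have "x \<noteq> z" using r \<open>a \<noteq> z\<close> by (simp add: x_def)
  ultimately show "A = A'" by simp
  then show "c = c'" using 1 by simp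
qed

text \<open>Piece i lies to the left of z and piece j to its right; they differ only when z is
  itself a subdivision point. The least index with \<open>z \<le> a i\<close> separates the
  cases.\<close>

lemma subdivision_pieces_at:
  assumes sub: "subdivision a k" and z: "0 < z" "z < 1"
  obtains i j where "i < k" "j < k" "a i < z" "z \<le> a (Suc i)" "a j \<le> z" "z < a (Suc j)"
    "i = j \<or> z = a j"
proof -
  have a: "a 0 = 0" "a k = 1" using sub by (auto simp: subdivision_def)
  define p where "p = (LEAST i. z \<le> a i)"
  have p: "z \<le> a p" "p \<le> k"
    unfolding p_def using z a LeastI[of "\<lambda>i. z \<le> a i" k] Least_le[of "\<lambda>i. z \<le> a i" k] by auto
  have before: "a i < z" if "i < p" for i
    using not_less_Least[of i "\<lambda>i. z \<le> a i"] that by (simp add: p_def)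
  have "p \<noteq> 0" using p z a by (cases p) auto
  then obtain i where i: "p = Suc i" by (cases p) auto
  show thesis
  proof (cases "z = a p")
    case True
    have "p \<noteq> k" using True z a by auto
    then show thesis using that[of i p] i p before[of i] sub True by (auto simp: subdivision_def)
  next
    case False
    then show thesis using that[of i i] i p before[of i] by auto
  qed
qed

lemma eventually_isCont_between:
  fixes f :: "real \<Rightarrow> real"
  assumes "isCont f z" "a < f z" "f z < b"
  shows "\<forall>\<^sub>F x in nhds z. a < f x \<and> f x < b"
proof -
  have "(f \<longlongrightarrow> f z) (nhds z)"
    using assms(1) by (simp add: isCont_def tendsto_at_iff_tendsto_nhds)
  from order_tendstoD[OF this] show ?thesis using assms(2,3) by (simp add: eventually_conj_iff)
qed

text \<open>The pullback F of f is piecewise in \<open>F\<^sub>n\<close>; what has to be shown is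
  that it does not break where two pieces meet at a point that is not n-adic.\<close>

lemma closed_if_bij:
  assumes n: "n \<ge> 2" and m: "m \<ge> 2" and \<phi>: "\<phi> \<in> homeo_plus"
    and H: "conj_F \<phi> n \<subseteq> thompson_F m"
    and bij: "bij_betw \<phi> (adic_rationals n \<inter> {0<..<1}) (adic_rationals m \<inter> {0<..<1})"
  shows "closed_in_F m (conj_F \<phi> n)"
  unfolding closed_in_F_def
proof (intro ballI impI)
  fix f assume f: "f \<in> thompson_F m" and pw: "piecewise_in (conj_F \<phi> n) f"
  let ?\<psi> = "inv_into UNIV \<phi>"
  have \<psi>: "?\<psi> \<in> homeo_plus" by (rule inv_homeo_plus[OF \<phi>])
  have adic_iff: "\<phi> z \<in> adic_rationals m \<longleftrightarrow> z \<in> adic_rationals n" if "0 < z" "z < 1" for z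
  proof -
    have "\<phi> z \<in> {0<..<1}"
      using that by (simp add: homeo_plus_0_less_iff[OF \<phi>] homeo_plus_less_1_iff[OF \<phi>])
    then have "\<phi> z \<in> adic_rationals m \<longleftrightarrow> \<phi> z \<in> \<phi> ` (adic_rationals n \<inter> {0<..<1})"
      using bij by (simp add: bij_betw_def)
    then show ?thesis using that by (auto simp: homeo_plus_eq_iff[OF \<phi>])
  qed
  obtain a k where sub: "subdivision a k"
    and pieces: "\<forall>j<k. \<exists>h\<in>conj_F \<phi> n. \<forall>x\<in>{a j..a (Suc j)}. f x = h x"
    using pw unfolding piecewise_in_def by blast
  have "\<forall>j. \<exists>g. j < k \<longrightarrow> g \<in> thompson_F n \<and>
      (\<forall>x\<in>{a j..a (Suc j)}. f x = (\<phi> \<circ> g \<circ> ?\<psi>) x)"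
    using pieces unfolding conj_F_def by blast
  from choice[OF this] obtain g where g_spec: "\<forall>j. j < k \<longrightarrow> g j \<in> thompson_F n \<and>
      (\<forall>x\<in>{a j..a (Suc j)}. f x = (\<phi> \<circ> g j \<circ> ?\<psi>) x)" by blast
  then have g: "g j \<in> thompson_F n" if "j < k" for j using that by blast
  have f_eq: "f x = (\<phi> \<circ> g j \<circ> ?\<psi>) x" if "j < k" "a j \<le> x" "x \<le> a (Suc j)" for j x
    using g_spec that by simp
  define F where "F = ?\<psi> \<circ> f \<circ> \<phi>"
  have f_F: "f = \<phi> \<circ> F \<circ> ?\<psi>"
    by (auto simp: F_def homeo_plus_f_inv[OF \<phi>])
  have F_homeo: "F \<in> homeo_plus"
    using f \<phi> \<psi> unfolding F_def thompson_F_iff by (intro comp_homeo_plus) auto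
  have F_eq: "F x = g j x" if "j < k" "a j \<le> \<phi> x" "\<phi> x \<le> a (Suc j)" for j x
    using f_eq[OF that] by (simp add: F_def homeo_plus_inv_f[OF \<phi>])
  have "\<forall>j. \<exists>B. j < k \<longrightarrow> finite B \<and> B \<subseteq> adic_rationals n \<and> (\<forall>z\<in>{0<..<1} - B. locally_affine n (g j) z)"
    using g unfolding thompson_F_iff by blast
  from choice[OF this] obtain B where B_spec: "\<forall>j. j < k \<longrightarrow> finite (B j) \<and> B j \<subseteq> adic_rationals n \<and>
      (\<forall>z\<in>{0<..<1} - B j. locally_affine n (g j) z)" by blast
  then have B: "finite (B j)" "B j \<subseteq> adic_rationals n" if "j < k" for j
    using that by blast+
  have g_aff: "locally_affine n (g j) z" if "j < k" "z \<in> {0<..<1} - B j" for j z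
    using B_spec that by blast
  define A where "A = (\<Union>j<k. B j) \<union> (?\<psi> ` a ` {..k} \<inter> adic_rationals n)"
  have "locally_affine n F z" if z: "z \<in> {0<..<1} - A" for z
  proof -
    have \<phi>z: "0 < \<phi> z" "\<phi> z < 1"
      using z by (auto simp: homeo_plus_0_less_iff[OF \<phi>] homeo_plus_less_1_iff[OF \<phi>])
    obtain i j where ij: "i < k" "j < k" "a i < \<phi> z" "\<phi> z \<le> a (Suc i)" "a j \<le> \<phi> z" "\<phi> z < a (Suc j)"
      "i = j \<or> \<phi> z = a j"
      using subdivision_pieces_at[OF sub \<phi>z] by blast
    have cont: "isCont \<phi> z" by (rule homeo_plus_isCont[OF \<phi>])
    have near: "\<forall>\<^sub>F x in nhds z. a i < \<phi> x \<and> \<phi> x < a (Suc j)"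
      by (rule eventually_isCont_between) (use cont ij in auto)
    have eq: "\<forall>\<^sub>F x in nhds z. g i x = g j x"
    proof (cases "i = j")
      case False
      then have aj: "\<phi> z = a j" using ij by blast
      then have "z \<in> ?\<psi> ` a ` {..k}"
        using ij(2) homeo_plus_inv_f[OF \<phi>, of z] by force
      then have "z \<notin> adic_rationals n" using z by (auto simp: A_def)
      \<comment> \<open>Here the matching of adic points enters: f and both conjugates belong to
        \<open>F\<^sub>m\<close>, so they are affine around the non-adic point
        \<open>\<phi> z\<close>.\<close>
      then have non: "\<phi> z \<notin> adic_rationals m" using z adic_iff by auto
      let ?h = "\<lambda>j. \<phi> \<circ> g j \<circ> ?\<psi>"
      have "locally_affine m h (\<phi> z)" if "h \<in> thompson_F m" for h
        using that non \<phi>z unfolding thompson_F_iff by auto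
      then have "locally_affine m f (\<phi> z)" "locally_affine m (?h i) (\<phi> z)" "locally_affine m (?h j) (\<phi> z)"
        using f g ij(1,2) conjugate_mem_thompson_F[OF H] by blast+
      then obtain s c s1 c1 s2 c2 where
        aff: "\<forall>\<^sub>F y in nhds (\<phi> z). f y = of_nat m powi s * y + c"
          "\<forall>\<^sub>F y in nhds (\<phi> z). ?h i y = of_nat m powi s1 * y + c1"
          "\<forall>\<^sub>F y in nhds (\<phi> z). ?h j y = of_nat m powi s2 * y + c2"
        unfolding locally_affine_def by blast
      \<comment> \<open>f follows \<open>?h i\<close> to the left of \<open>\<phi> z\<close> and
        \<open>?h j\<close> to its right, so each of them shares the affine germ of f.\<close>
      have i_coeffs: "of_nat m powi s = (of_nat m powi s1 :: real) \<and> c = c1"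
        using affine_germs_agree[OF aff(1,2), of "a i"] f_eq[OF ij(1)] ij
        by (auto simp: closed_segment_eq_real_ivl)
      have j_coeffs: "of_nat m powi s = (of_nat m powi s2 :: real) \<and> c = c2"
        using affine_germs_agree[OF aff(1,3), of "a (Suc j)"] f_eq[OF ij(2)] ij
        by (auto simp: closed_segment_eq_real_ivl)
      from aff(2,3) have "\<forall>\<^sub>F y in nhds (\<phi> z). ?h i y = ?h j y"
        by eventually_elim (use i_coeffs j_coeffs in auto)
      then have "\<forall>\<^sub>F x in nhds z. ?h i (\<phi> x) = ?h j (\<phi> x)"
        by (rule eventually_compose_filterlim) (use cont in \<open>simp add: isCont_def tendsto_at_iff_tendsto_nhds\<close>)
      then show ?thesis
        by (simp add: homeo_plus_inv_f[OF \<phi>] homeo_plus_eq_iff[OF \<phi>])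
    qed simp
    \<comment> \<open>F equals \<open>g i\<close> on the left and \<open>g j\<close> on the right,
      and these two agree near z.\<close>
    have F_g: "\<forall>\<^sub>F x in nhds z. F x = g i x"
      using near eq
    proof eventually_elim
      case (elim x)
      show ?case
      proof (cases "\<phi> x \<le> a (Suc i)")
        case True
        then show ?thesis using F_eq ij elim by auto
      next
        case False
        then have "a j \<le> \<phi> x" using ij by auto
        then show ?thesis using F_eq[of j x] ij elim by auto
      qed
    qed
    have "locally_affine n (g i) z"
      using g_aff[OF ij(1)] z ij(1) by (auto simp: A_def)
    then obtain s c where "\<forall>\<^sub>F x in nhds z. g i x = of_nat n powi s * x + c"
      unfolding locally_affine_def by blast
    with F_g have "\<forall>\<^sub>F x in nhds z. F x = of_nat n powi s * x + c"
      by eventually_elim simp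
    then show ?thesis unfolding locally_affine_def by blast
  qed
  moreover have "finite A" "A \<subseteq> adic_rationals n"
    using B by (auto simp: A_def)
  ultimately have "F \<in> thompson_F n"
    using F_homeo unfolding thompson_F_iff by blast
  then show "f \<in> conj_F \<phi> n" unfolding conj_F_iff f_F by blast
qed

section \<open>From closedness to matched adic points\<close>

lemma id_mem_thompson_F: "id \<in> thompson_F n"
  unfolding thompson_F_iff
proof (intro conjI exI[of _ "{}"] ballI)
  show "id \<in> homeo_plus" by (simp add: homeo_plus_iff strict_mono_def)
  show "locally_affine n id z" for z
    by (rule locally_affineI[of "z - 1" z "z + 1" id n 0 0]) auto
qed simp_all

lemma bij_if_closed:
  assumes n: "n \<ge> 2" and m: "m \<ge> 2" and \<phi>: "\<phi> \<in> homeo_plus"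
    and sub: "subgroup (conj_F \<phi> n) (thompson_group m)"
    and closed: "closed_in_F m (conj_F \<phi> n)"
  shows "bij_betw \<phi> (adic_rationals n \<inter> {0<..<1}) (adic_rationals m \<inter> {0<..<1})"
proof -
  let ?\<psi> = "inv_into UNIV \<phi>"
  have \<psi>: "?\<psi> \<in> homeo_plus" by (rule inv_homeo_plus[OF \<phi>])
  note \<phi>_simps = homeo_plus_0_less_iff[OF \<phi>] homeo_plus_less_1_iff[OF \<phi>] homeo_plus_0_le_iff[OF \<phi>]
    homeo_plus_le_1_iff[OF \<phi>] homeo_plus_less_iff[OF \<phi>] homeo_plus_le_iff[OF \<phi>] homeo_plus_eq_iff[OF \<phi>]
    homeo_plus_inv_f[OF \<phi>] homeo_plus_f_inv[OF \<phi>] homeo_plus_0_less_iff[OF \<psi>] homeo_plus_less_1_iff[OF \<psi>]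
    homeo_plus_0_le_iff[OF \<psi>] homeo_plus_le_1_iff[OF \<psi>] homeo_plus_less_iff[OF \<psi>]
    homeo_plus_le_iff[OF \<psi>] homeo_plus_eq_iff[OF \<psi>]
  have n0: "n > 0" "real n > 0" and m0: "m > 0" using n m by auto
  have H: "conj_F \<phi> n \<subseteq> thompson_F m"
    using subgroup.subset[OF sub] by (simp add: thompson_group_def)
  have \<phi>_adic: "\<phi> x \<in> adic_rationals m" if "x \<in> adic_rationals n" "0 \<le> x" "x \<le> 1" for x
  proof (cases "0 < x \<and> x < 1")
    case True
    then show ?thesis using adic_image_adic[OF n m0 \<phi> H] that by blast
  next
    case False
    then have "x = 0 \<or> x = 1" using that by auto
    then show ?thesis using homeo_plus_outside[OF \<phi>, of x] by (auto intro: adic_rationals_Ints)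
  qed
  \<comment> \<open>The number of cells in \<open>cell_expansion\<close>; each cell gets its own
    element \<open>g j\<close> with slope n there.\<close>
  define N where "N = n ^ 3"
  have N: "N > 0" "real N = real n ^ 3" using n0 by (simp_all add: N_def)
  have "\<forall>j. \<exists>g c. j < N \<longrightarrow> g \<in> thompson_F n \<and> c \<in> adic_rationals n \<and>
      (\<forall>x\<in>{of_nat j / of_nat N..of_nat (Suc j) / of_nat N}. g x = of_nat n * x + c) \<and>
      (\<forall>x\<in>{of_nat j / of_nat N..<of_nat (Suc j) / of_nat N}. g x \<in> {0..<1})"
  proof (intro allI)
    fix j
    show "\<exists>g c. j < N \<longrightarrow> g \<in> thompson_F n \<and> c \<in> adic_rationals n \<and>
      (\<forall>x\<in>{of_nat j / of_nat N..of_nat (Suc j) / of_nat N}. g x = of_nat n * x + c) \<and>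
      (\<forall>x\<in>{of_nat j / of_nat N..<of_nat (Suc j) / of_nat N}. g x \<in> {0..<1})"
    proof (cases "j < N")
      case True
      then have j3: "j < n ^ 3" by (simp add: N_def)
      obtain g c where gc: "g \<in> thompson_F n" "c \<in> adic_rationals n"
        "\<And>x. x \<in> {of_nat j / of_nat n ^ 3..of_nat (Suc j) / of_nat n ^ 3} \<Longrightarrow> g x = of_nat n * x + c"
        "\<And>x. x \<in> {of_nat j / of_nat n ^ 3..<of_nat (Suc j) / of_nat n ^ 3} \<Longrightarrow> g x \<in> {0..<1}"
        by (rule cell_expansion[OF n j3]) (rule that)
      show ?thesis
        unfolding N(2) by (intro exI[of _ g] exI[of _ c] impI conjI ballI gc)
    qed simp
  qed
  from choice[OF this] obtain g where "\<forall>j. \<exists>c. j < N \<longrightarrow> g j \<in> thompson_F n \<and> c \<in> adic_rationals n \<and>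
      (\<forall>x\<in>{of_nat j / of_nat N..of_nat (Suc j) / of_nat N}. g j x = of_nat n * x + c) \<and>
      (\<forall>x\<in>{of_nat j / of_nat N..<of_nat (Suc j) / of_nat N}. g j x \<in> {0..<1})" by blast
  from choice[OF this] obtain c where gc: "\<forall>j. j < N \<longrightarrow> g j \<in> thompson_F n \<and> c j \<in> adic_rationals n \<and>
      (\<forall>x\<in>{of_nat j / of_nat N..of_nat (Suc j) / of_nat N}. g j x = of_nat n * x + c j) \<and>
      (\<forall>x\<in>{of_nat j / of_nat N..<of_nat (Suc j) / of_nat N}. g j x \<in> {0..<1})" by blast
  then have g: "g j \<in> thompson_F n" and c: "c j \<in> adic_rationals n" if "j < N" for j
    using that by blast+
  have g_eq: "g j x = of_nat n * x + c j"
    if "j < N" "of_nat j / of_nat N \<le> x" "x \<le> of_nat (Suc j) / of_nat N" for j x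
    using gc that by simp
  have g_maps: "g j x \<in> {0..<1}"
    if "j < N" "of_nat j / of_nat N \<le> x" "x < of_nat (Suc j) / of_nat N" for j x
  proof -
    have "x \<in> {of_nat j / of_nat N..<of_nat (Suc j) / of_nat N}" using that by auto
    then show ?thesis using gc that(1) by blast
  qed
  \<comment> \<open>Cells are closed on the left and open on the right, so that at a grid point the
    branch to its right is used, as \<open>adic_orbit_preperiodic\<close> requires.\<close>
  define cell where "cell x = nat \<lfloor>x * of_nat N\<rfloor>" for x :: real
  have cell_iff: "cell x = j \<longleftrightarrow> of_nat j / of_nat N \<le> x \<and> x < of_nat (Suc j) / of_nat N"
    if "0 \<le> x" for x j
  proof -
    have "0 \<le> x * of_nat N" using that by simp
    then have "cell x = j \<longleftrightarrow> of_nat j \<le> x * of_nat N \<and> x * of_nat N < of_nat (Suc j)"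
      unfolding cell_def by linarith
    then show ?thesis using N(1) by (simp add: pos_divide_le_eq pos_less_divide_eq)
  qed
  have cell_bounds: "of_nat (cell x) / of_nat N \<le> x" "x < of_nat (Suc (cell x)) / of_nat N"
    if "0 \<le> x" for x
    using cell_iff[OF that] by blast+
  have cell_less: "cell x < N" if "x \<in> {0..<1}" for x
  proof -
    have "of_nat (cell x) / of_nat N < (1::real)" using cell_bounds(1)[of x] that by auto
    then show ?thesis using N(1) by simp
  qed
  define E where "E x = g (cell x) x" for x
  have E_eq: "E x = of_nat n * x + c (cell x)" and E_maps: "E x \<in> {0..<1}" if "x \<in> {0..<1}" for x
    using g_eq[OF cell_less[OF that], of x] g_maps[OF cell_less[OF that], of x] cell_bounds[of x] that
    by (auto simp: E_def)
  have E_iter: "(E ^^ k) x \<in> {0..<1}" if "x \<in> {0..<1}" for x k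
    using that by (induction k) (use E_maps in auto)
  \<comment> \<open>On the image of cell j this conjugate of the expanding map E coincides with a
    single element of \<open>F\<^sub>m\<close>.\<close>
  define T where "T y = \<phi> (E (?\<psi> y))" for y
  have T_iter: "(T ^^ k) y = \<phi> ((E ^^ k) (?\<psi> y))" for k y
    by (induction k) (simp_all add: T_def \<phi>_simps)
  have grid_adic: "of_nat j / of_nat N \<in> adic_rationals n" for j
    unfolding N(2) by (intro adic_divide_power n0 adic_rationals_Ints) simp
  define h where "h j = \<phi> \<circ> g j \<circ> ?\<psi>" for j
  have h: "h j \<in> thompson_F m" if "j < N" for j
    unfolding h_def by (rule conjugate_mem_thompson_F[OF H g[OF that]])
  then have h_homeo: "h j \<in> homeo_plus" if "j < N" for j
    using that unfolding thompson_F_iff by blast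
  have "\<forall>j. \<exists>B. j < N \<longrightarrow> finite B \<and> B \<subseteq> adic_rationals m \<and> (\<forall>z\<in>{0<..<1} - B. locally_affine m (h j) z)"
    using h unfolding thompson_F_iff by blast
  from choice[OF this] obtain BB where BB_spec: "\<forall>j. j < N \<longrightarrow> finite (BB j) \<and> BB j \<subseteq> adic_rationals m \<and>
      (\<forall>z\<in>{0<..<1} - BB j. locally_affine m (h j) z)" by blast
  then have BB: "finite (BB j)" "BB j \<subseteq> adic_rationals m" if "j < N" for j
    using that by blast+
  have h_aff: "locally_affine m (h j) z" if "j < N" "z \<in> {0<..<1} - BB j" for j z
    using BB_spec that by blast
  \<comment> \<open>Grid images join the breaks of the conjugated pieces, so that between neighbours
    in B one piece is in force and is affine; the indices 0 and N supply the end points.\<close>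
  define B where "B = (\<Union>j<N. BB j) \<inter> {0..1} \<union> (\<lambda>j. \<phi> (of_nat j / of_nat N)) ` {..N}"
  have grid_B: "\<phi> (of_nat j / of_nat N) \<in> B" if "j \<le> N" for j
    using that by (auto simp: B_def)
  have B: "finite B" "B \<subseteq> adic_rationals m" "0 \<in> B" "1 \<in> B"
  proof -
    show "finite B" using BB by (auto simp: B_def)
    have "\<phi> (of_nat j / of_nat N) \<in> adic_rationals m" if "j \<le> N" for j
      using that N(1) by (intro \<phi>_adic grid_adic) auto
    then show "B \<subseteq> adic_rationals m" using BB by (auto simp: B_def)
    show "0 \<in> B" "1 \<in> B"
      using grid_B[of 0] grid_B[of N] N(1) homeo_plus_outside[OF \<phi>, of 0] homeo_plus_outside[OF \<phi>, of 1]
      by simp_all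
  qed
  have piece: "\<exists>s d. d \<in> adic_rationals m \<and> (\<forall>y. \<beta> \<le> y \<longrightarrow> y < 1 \<longrightarrow>
      (\<forall>\<gamma>\<in>B. \<not> (\<beta> < \<gamma> \<and> \<gamma> \<le> y)) \<longrightarrow> T y = of_nat m powi s * y + d)"
    if \<beta>: "\<beta> \<in> B" "0 \<le> \<beta>" "\<beta> < 1" for \<beta>
  proof -
    \<comment> \<open>q is the next point of B after \<beta>, and a single affine formula has to
      hold up to it.\<close>
    define q where "q = Min {\<gamma> \<in> B. \<beta> < \<gamma>}"
    have fin: "finite {\<gamma> \<in> B. \<beta> < \<gamma>}" and ne: "{\<gamma> \<in> B. \<beta> < \<gamma>} \<noteq> {}" using B \<beta> by auto
    have q: "q \<in> B" "\<beta> < q" using Min_in[OF fin ne] by (auto simp: q_def)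
    have q_le: "q \<le> \<gamma>" if "\<gamma> \<in> B" "\<beta> < \<gamma>" for \<gamma>
      using Min_le[OF fin, of \<gamma>] that by (simp add: q_def)
    have q1: "q \<le> 1" using q_le[OF B(4)] \<beta> by simp
    define j where "j = cell (?\<psi> \<beta>)"
    have \<psi>\<beta>: "?\<psi> \<beta> \<in> {0..<1}" using \<beta> by (simp add: \<phi>_simps)
    have jN: "j < N" unfolding j_def by (rule cell_less[OF \<psi>\<beta>])
    have cell_j: "cell (?\<psi> y) = j" if "\<beta> \<le> y" "y < q" for y
    proof -
      have lo: "of_nat j / of_nat N \<le> ?\<psi> \<beta>" and hi: "?\<psi> \<beta> < of_nat (Suc j) / of_nat N"
        using cell_bounds[of "?\<psi> \<beta>"] \<psi>\<beta> by (auto simp: j_def)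
      have "?\<psi> \<beta> \<le> ?\<psi> y" using that by (simp add: \<phi>_simps)
      have "\<phi> (?\<psi> \<beta>) < \<phi> (of_nat (Suc j) / of_nat N)" using hi by (simp only: homeo_plus_less_iff[OF \<phi>])
      then have "q \<le> \<phi> (of_nat (Suc j) / of_nat N)"
        using jN by (intro q_le grid_B) (auto simp: \<phi>_simps)
      then have "\<phi> (?\<psi> y) < \<phi> (of_nat (Suc j) / of_nat N)" using that by (simp add: \<phi>_simps)
      then have "?\<psi> y < of_nat (Suc j) / of_nat N" by (simp only: homeo_plus_less_iff[OF \<phi>])
      then show ?thesis
        using lo \<open>?\<psi> \<beta> \<le> ?\<psi> y\<close> \<psi>\<beta> by (subst cell_iff) auto
    qed
    have T_h: "T y = h j y" if "\<beta> \<le> y" "y < q" for y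
      using cell_j[OF that] by (simp add: T_def E_def h_def)
    have "\<exists>s d. \<forall>y\<in>{\<beta>..q}. h j y = of_nat m powi s * y + d"
    proof (rule affine_on_interval[OF h_homeo[OF jN] q(2)])
      fix z assume z: "z \<in> {\<beta><..<q}"
      then have "z \<notin> B" using q_le[of z] by auto
      then show "locally_affine m (h j) z"
        using z \<beta> q1 jN by (intro h_aff) (auto simp: B_def)
    qed
    then obtain s d where h_eq: "\<And>y. \<beta> \<le> y \<Longrightarrow> y \<le> q \<Longrightarrow> h j y = of_nat m powi s * y + d" by auto
    \<comment> \<open>The offset is tested at \<open>\<phi> x\<close> with x n-adic: then both
      \<open>\<phi> x\<close> and \<open>T (\<phi> x) = \<phi> (E x)\<close> are m-adic. This is not
      known at \<beta>, whose preimage might fail to be n-adic.\<close>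
    obtain x where x: "x \<in> adic_rationals n" "?\<psi> \<beta> < x" "x < ?\<psi> q"
      using adic_dense[OF n0(1) n, of "?\<psi> \<beta>" "?\<psi> q"] q(2) by (auto simp: \<phi>_simps)
    have x01: "x \<in> {0..<1}"
      using x \<psi>\<beta> q1 homeo_plus_le_1_iff[OF \<psi>, of q] by auto
    have "\<phi> (?\<psi> \<beta>) < \<phi> x" "\<phi> x < \<phi> (?\<psi> q)" using x(2,3) by (simp_all only: homeo_plus_less_iff[OF \<phi>])
    then have \<phi>x: "\<beta> < \<phi> x" "\<phi> x < q" by (simp_all add: \<phi>_simps)
    have "E x \<in> adic_rationals n"
      unfolding E_eq[OF x01] using x(1) c[OF cell_less[OF x01]]
      by (intro adic_add adic_mult n0 adic_rationals_Ints[of "of_nat n"]) auto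
    then have "T (\<phi> x) \<in> adic_rationals m"
      using \<phi>_adic[of "E x"] E_maps[OF x01] by (simp add: T_def \<phi>_simps)
    moreover have T_\<phi>x: "T (\<phi> x) = of_nat m powi s * \<phi> x + d"
      using T_h[of "\<phi> x"] h_eq[of "\<phi> x"] \<phi>x by simp
    moreover have "\<phi> x \<in> adic_rationals m" using \<phi>_adic[OF x(1)] x01 by simp
    ultimately have "T (\<phi> x) - of_nat m powi s * \<phi> x \<in> adic_rationals m"
      by (intro adic_diff adic_mult m0 adic_power_int)
    then have "d \<in> adic_rationals m" using T_\<phi>x by simp
    moreover have "T y = of_nat m powi s * y + d"
      if "\<beta> \<le> y" "\<forall>\<gamma>\<in>B. \<not> (\<beta> < \<gamma> \<and> \<gamma> \<le> y)" for y
    proof -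
      have "y < q" using that(2) q by force
      then show ?thesis using T_h[of y] h_eq[of y] that(1) by simp
    qed
    ultimately show ?thesis by blast
  qed
  then have "\<forall>\<beta>. \<exists>s d. \<beta> \<in> B \<longrightarrow> 0 \<le> \<beta> \<longrightarrow> \<beta> < 1 \<longrightarrow> d \<in> adic_rationals m \<and> (\<forall>y. \<beta> \<le> y \<longrightarrow> y < 1 \<longrightarrow>
      (\<forall>\<gamma>\<in>B. \<not> (\<beta> < \<gamma> \<and> \<gamma> \<le> y)) \<longrightarrow> T y = of_nat m powi s * y + d)"
    by blast
  from choice[OF this] obtain s where "\<forall>\<beta>. \<exists>d. \<beta> \<in> B \<longrightarrow> 0 \<le> \<beta> \<longrightarrow> \<beta> < 1 \<longrightarrow> d \<in> adic_rationals m \<and> (\<forall>y. \<beta> \<le> y \<longrightarrow> y < 1 \<longrightarrow>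
      (\<forall>\<gamma>\<in>B. \<not> (\<beta> < \<gamma> \<and> \<gamma> \<le> y)) \<longrightarrow> T y = of_nat m powi s \<beta> * y + d)" by blast
  from choice[OF this] obtain d where sd: "\<forall>\<beta>. \<beta> \<in> B \<longrightarrow> 0 \<le> \<beta> \<longrightarrow> \<beta> < 1 \<longrightarrow> d \<beta> \<in> adic_rationals m \<and> (\<forall>y. \<beta> \<le> y \<longrightarrow> y < 1 \<longrightarrow>
      (\<forall>\<gamma>\<in>B. \<not> (\<beta> < \<gamma> \<and> \<gamma> \<le> y)) \<longrightarrow> T y = of_nat m powi s \<beta> * y + d \<beta>)" by blast
  \<comment> \<open>As long as no point of B separates the two orbits, E multiplies their distance
    by n, which cannot go on inside [0,1).\<close>
  have expansive: "\<exists>k. \<exists>\<beta>\<in>B. (T ^^ k) x < \<beta> \<and> \<beta> \<le> (T ^^ k) y" if xy: "0 \<le> x" "x < y" "y < 1" for x y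
  proof (rule ccontr)
    assume "\<not> ?thesis"
    then have none: "\<not> ((T ^^ k) x < \<beta> \<and> \<beta> \<le> (T ^^ k) y)" if "\<beta> \<in> B" for k \<beta>
      using that by blast
    define u where "u k = (E ^^ k) (?\<psi> x)" for k
    define v where "v k = (E ^^ k) (?\<psi> y)" for k
    have uv: "u k \<in> {0..<1}" "v k \<in> {0..<1}" for k
      unfolding u_def v_def using xy by (intro E_iter; simp add: \<phi>_simps)+
    have gap: "v k - u k = of_nat n ^ k * (?\<psi> y - ?\<psi> x)" for k
    proof (induction k)
      case (Suc k)
      have "?\<psi> x < ?\<psi> y" using xy(2) by (simp add: \<phi>_simps)
      then have "0 < of_nat n ^ k * (?\<psi> y - ?\<psi> x)" using n0 by simp
      then have less: "u k < v k" using Suc by linarith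
      \<comment> \<open>Otherwise the left end of the cell of \<open>v k\<close> would separate the
        points, and its image under \<phi> belongs to B.\<close>
      have "cell (u k) = cell (v k)"
      proof (rule ccontr)
        assume neq: "cell (u k) \<noteq> cell (v k)"
        have "u k < of_nat (cell (v k)) / of_nat N"
        proof (rule ccontr)
          assume "\<not> ?thesis"
          then have "cell (u k) = cell (v k)"
            using cell_bounds[of "v k"] uv[of k] less by (subst cell_iff) auto
          then show False using neq by simp
        qed
        moreover have "of_nat (cell (v k)) / of_nat N \<le> v k" using cell_bounds uv by auto
        moreover have "\<phi> (of_nat (cell (v k)) / of_nat N) \<in> B"
          using cell_less[OF uv(2)[of k]] by (intro grid_B) simp
        ultimately show False
          using none[of "\<phi> (of_nat (cell (v k)) / of_nat N)" k] by (simp add: T_iter u_def v_def \<phi>_simps)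
      qed
      then have "v (Suc k) - u (Suc k) = of_nat n * (v k - u k)"
        using E_eq[OF uv(1)[of k]] E_eq[OF uv(2)[of k]] by (simp add: u_def v_def right_diff_distrib)
      then show ?case using Suc by simp
    qed (simp add: u_def v_def)
    have pos: "?\<psi> y - ?\<psi> x > 0" using xy(2) by (simp add: \<phi>_simps)
    obtain k where "1 / (?\<psi> y - ?\<psi> x) < of_nat n ^ k"
      using real_arch_pow[of "of_nat n"] n by auto
    then have "1 < of_nat n ^ k * (?\<psi> y - ?\<psi> x)" using pos by (simp add: pos_divide_less_eq)
    then show False using gap[of k] uv[of k] by simp
  qed
  have inv_adic: "b \<in> adic_rationals n" if b: "0 < b" "b < 1" "\<phi> b \<in> adic_rationals m" for b
  proof (rule ccontr)
    assume nonadic: "b \<notin> adic_rationals n"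
    have a: "\<phi> b \<in> {0..<1}" using b by (simp add: \<phi>_simps)
    have "\<exists>k l. k < l \<and> (T ^^ k) (\<phi> b) = (T ^^ l) (\<phi> b)"
    proof (rule adic_orbit_preperiodic[where T = T and B = B and m = m and t = s and c = d and a = "\<phi> b"])
      show "T y \<in> {0..<1}" if "y \<in> {0..<1}" for y
        using E_maps[of "?\<psi> y"] that by (simp add: T_def \<phi>_simps)
      show "T y = of_nat m powi s \<beta> * y + d \<beta>"
        if "\<beta> \<in> B" "0 \<le> \<beta>" "\<beta> \<le> y" "y < 1" "\<forall>\<gamma>\<in>B. \<not> (\<beta> < \<gamma> \<and> \<gamma> \<le> y)" for \<beta> y
        using sd that by force
      show "d \<beta> \<in> adic_rationals m" if "\<beta> \<in> B" "0 \<le> \<beta>" "\<beta> < 1" for \<beta>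
        using sd that by blast
    qed (fact m B expansive a b)+
    then obtain k l where kl: "k < l" "(T ^^ k) (\<phi> b) = (T ^^ l) (\<phi> b)" by blast
    then have E_kl: "(E ^^ k) b = (E ^^ l) b" by (simp add: T_iter \<phi>_simps)
    \<comment> \<open>E can be inverted on each cell by an affine map with n-adic coefficients, so
      the orbit of b stays non-adic and in particular avoids the grid.\<close>
    have E_b: "(E ^^ i) b \<in> {0..<1} \<and> (E ^^ i) b \<notin> adic_rationals n" for i
    proof (induction i)
      case 0 show ?case using b nonadic by simp
    next
      case (Suc i)
      let ?x = "(E ^^ i) b"
      have x: "?x \<in> {0..<1}" "?x \<notin> adic_rationals n" using Suc by auto
      have "?x = (E ?x - c (cell ?x)) / of_nat n ^ 1" using E_eq[OF x(1)] n0 by simp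
      then have "E ?x \<notin> adic_rationals n"
        using x(2) c[OF cell_less[OF x(1)]] adic_divide_power[OF n0(1) adic_diff[OF n0(1)]] by metis
      then show ?case using E_maps[OF x(1)] by simp
    qed
    \<comment> \<open>The orbit of b runs through interiors of cells, so near b the iterate of E is
      a composition of elements \<open>g j\<close>; a single G in \<open>F\<^sub>n\<close> realises
      this germ, with slope n to the power i.\<close>
    have "\<exists>G C. G \<in> thompson_F n \<and> (\<forall>\<^sub>F x in nhds b. G x = of_nat n ^ i * x + C) \<and> G b = (E ^^ i) b" for i
    proof (induction i)
      case 0
      show ?case by (intro exI[of _ id] exI[of _ 0] conjI id_mem_thompson_F) simp_all
    next
      case (Suc i)
      then obtain G C where G: "G \<in> thompson_F n" "\<forall>\<^sub>F x in nhds b. G x = of_nat n ^ i * x + C"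
        "G b = (E ^^ i) b" by blast
      let ?x = "(E ^^ i) b"
      define j where "j = cell ?x"
      have x: "?x \<in> {0..<1}" "?x \<notin> adic_rationals n" using E_b by auto
      have jN: "j < N" unfolding j_def by (rule cell_less[OF x(1)])
      have "?x \<noteq> of_nat j / of_nat N" using x(2) grid_adic by metis
      then have "of_nat j / of_nat N < ?x" "?x < of_nat (Suc j) / of_nat N"
        using cell_bounds[of ?x] x(1) by (auto simp: j_def)
      moreover have "isCont G b" using G(1) homeo_plus_isCont unfolding thompson_F_iff by blast
      ultimately have "\<forall>\<^sub>F x in nhds b. of_nat j / of_nat N < G x \<and> G x < of_nat (Suc j) / of_nat N"
        using G(3) by (intro eventually_isCont_between) simp_all
      then have "\<forall>\<^sub>F x in nhds b. (g j \<circ> G) x = of_nat n ^ Suc i * x + (of_nat n * C + c j)"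
        using G(2)
      proof eventually_elim
        case (elim x)
        then have "g j (G x) = of_nat n * G x + c j" using jN by (intro g_eq) auto
        then show ?case using elim by (simp add: algebra_simps)
      qed
      moreover have "(g j \<circ> G) b = (E ^^ Suc i) b" using G(3) by (simp add: E_def j_def)
      moreover have "g j \<circ> G \<in> thompson_F n"
        by (rule thompson_F_comp[OF \<phi> sub g[OF jN] G(1)])
      ultimately show ?case by blast
    qed
    then have "\<forall>i. \<exists>G C. G \<in> thompson_F n \<and> (\<forall>\<^sub>F x in nhds b. G x = of_nat n ^ i * x + C) \<and> G b = (E ^^ i) b"
      by blast
    from choice[OF this] obtain G where
      G_spec: "\<forall>i. \<exists>C. G i \<in> thompson_F n \<and> (\<forall>\<^sub>F x in nhds b. G i x = of_nat n ^ i * x + C) \<and> G i b = (E ^^ i) b"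
      by blast
    then have G: "G i \<in> thompson_F n" and G_b: "G i b = (E ^^ i) b" for i by blast+
    have G_homeo: "G i \<in> homeo_plus" for i using G unfolding thompson_F_iff by blast
    have G_kl: "G k b = G l b" using G_b E_kl by simp
    \<comment> \<open>The two elements agree at b but have slopes n to the powers k and l there, so
      F has a genuine break at the non-adic point b.\<close>
    define F where "F x = (if x \<le> b then G k x else G l x)" for x
    have F_homeo: "F \<in> homeo_plus"
      unfolding homeo_plus_iff
    proof (intro conjI allI impI)
      show "strict_mono F"
      proof (rule strict_monoI)
        fix x y :: real assume "x < y"
        consider "y \<le> b" | "b < x" | "x \<le> b" "b < y" using \<open>x < y\<close> by linarith
        then show "F x < F y"
        proof cases
          case 3
          then have "G k x \<le> G k b" "G l b < G l y"
            by (simp_all add: homeo_plus_le_iff[OF G_homeo] homeo_plus_less_iff[OF G_homeo])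
          then show ?thesis using 3 G_kl by (simp add: F_def)
        qed (use \<open>x < y\<close> in \<open>auto simp: F_def homeo_plus_less_iff[OF G_homeo]\<close>)
      qed
      have "\<exists>x. F x = y" for y
      proof (cases "y \<le> G k b")
        case True
        let ?x = "inv_into UNIV (G k) y"
        have "G k ?x = y" by (rule homeo_plus_f_inv[OF G_homeo])
        then have "?x \<le> b" using True homeo_plus_le_iff[OF G_homeo[of k], of ?x b] by simp
        then show ?thesis using \<open>G k ?x = y\<close> by (intro exI[of _ ?x]) (simp add: F_def)
      next
        case False
        let ?x = "inv_into UNIV (G l) y"
        have "G l ?x = y" by (rule homeo_plus_f_inv[OF G_homeo])
        then have "\<not> ?x \<le> b" using False G_kl homeo_plus_le_iff[OF G_homeo[of l], of ?x b] by simp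
        then show ?thesis using \<open>G l ?x = y\<close> by (intro exI[of _ ?x]) (simp add: F_def)
      qed
      then show "surj F" by (metis surjI)
      show "F x = x" if "x \<notin> {0<..<1}" for x
        using homeo_plus_outside[OF G_homeo that] by (simp add: F_def)
    qed
    define f where "f = \<phi> \<circ> F \<circ> ?\<psi>"
    let ?h = "\<lambda>i. \<phi> \<circ> G i \<circ> ?\<psi>"
    have \<psi>_le: "?\<psi> y \<le> b \<longleftrightarrow> y \<le> \<phi> b" for y
      using homeo_plus_le_iff[OF \<psi>, of y "\<phi> b"] by (simp add: homeo_plus_inv_f[OF \<phi>])
    have f_eq: "f y = (if y \<le> \<phi> b then ?h k y else ?h l y)" for y
      by (simp add: f_def F_def \<psi>_le)
    have f_eq': "f y = ?h l y" if "\<phi> b \<le> y" for y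
      using that G_kl by (cases "y = \<phi> b") (auto simp: f_eq homeo_plus_inv_f[OF \<phi>])
    have "\<forall>i. \<exists>A. finite A \<and> A \<subseteq> adic_rationals m \<and> (\<forall>z\<in>{0<..<1} - A. locally_affine m (?h i) z)"
      using conjugate_mem_thompson_F[OF H G] unfolding thompson_F_iff by blast
    from choice[OF this] obtain A where A_spec: "\<forall>i. finite (A i) \<and> A i \<subseteq> adic_rationals m \<and>
        (\<forall>z\<in>{0<..<1} - A i. locally_affine m (?h i) z)" by blast
    then have A: "finite (A i)" "A i \<subseteq> adic_rationals m" for i by blast+
    have h_loc: "locally_affine m (?h i) z" if "z \<in> {0<..<1} - A i" for i z
      using A_spec that by blast
    \<comment> \<open>\<open>\<phi> b\<close> is m-adic, so f may break there; everywhere else f is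
      locally one of the two conjugates.\<close>
    have "locally_affine m f z" if z: "z \<in> {0<..<1} - (A k \<union> A l \<union> {\<phi> b})" for z
    proof -
      have "\<exists>i\<in>{k, l}. \<forall>\<^sub>F x in nhds z. f x = ?h i x"
      proof (cases "z < \<phi> b")
        case True
        have "\<forall>\<^sub>F x in nhds z. x \<in> {..<\<phi> b}" using True by (intro eventually_nhds_in_open) auto
        then have "\<forall>\<^sub>F x in nhds z. f x = ?h k x" by eventually_elim (simp add: f_eq)
        then show ?thesis by blast
      next
        case False
        have "\<forall>\<^sub>F x in nhds z. x \<in> {\<phi> b<..}" using False z by (intro eventually_nhds_in_open) auto
        then have "\<forall>\<^sub>F x in nhds z. f x = ?h l x" by eventually_elim (simp add: f_eq)
        then show ?thesis by blast
      qed
      then obtain i where i: "i \<in> {k, l}" "\<forall>\<^sub>F x in nhds z. f x = ?h i x" by blast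
      then have "locally_affine m (?h i) z" using z by (intro h_loc) auto
      then obtain s c where "\<forall>\<^sub>F x in nhds z. ?h i x = of_nat m powi s * x + c"
        unfolding locally_affine_def by blast
      then have "\<forall>\<^sub>F x in nhds z. f x = of_nat m powi s * x + c"
        using i(2) by eventually_elim simp
      then show ?thesis unfolding locally_affine_def by blast
    qed
    moreover have "f \<in> homeo_plus" unfolding f_def using F_homeo \<phi> \<psi> by (intro comp_homeo_plus)
    ultimately have "f \<in> thompson_F m"
      using A b(3) unfolding thompson_F_iff by (intro conjI exI[of _ "A k \<union> A l \<union> {\<phi> b}"]) auto
    moreover have "piecewise_in (conj_F \<phi> n) f"
      unfolding piecewise_in_def
    proof (intro exI[of _ "\<lambda>i. [0, \<phi> b, 1] ! i"] exI[of _ "2::nat"] conjI allI impI)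
      show "subdivision (\<lambda>i. [0, \<phi> b, 1] ! i) 2"
        using b by (auto simp: subdivision_def less_2_cases_iff \<phi>_simps)
      fix i :: nat assume "i < 2"
      have h_mem: "?h i \<in> conj_F \<phi> n" for i using G unfolding conj_F_iff by blast
      have "f x = ?h (if i = 0 then k else l) x" if "x \<in> {[0, \<phi> b, 1] ! i..[0, \<phi> b, 1] ! Suc i}" for x
        using f_eq[of x] f_eq'[of x] \<open>i < 2\<close> that by (auto simp: less_2_cases_iff)
      then show "\<exists>h\<in>conj_F \<phi> n. \<forall>x\<in>{[0, \<phi> b, 1] ! i..[0, \<phi> b, 1] ! Suc i}. f x = h x"
        using h_mem by blast
    qed
    ultimately have "f \<in> conj_F \<phi> n" using closed unfolding closed_in_F_def by blast
    then obtain F' where F': "F' \<in> thompson_F n" "f = \<phi> \<circ> F' \<circ> ?\<psi>" unfolding conj_F_iff by blast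
    have "F x = F' x" for x
      using fun_cong[OF F'(2), of "\<phi> x"] by (simp add: f_def \<phi>_simps)
    then have "F = F'" by auto
    then have "locally_affine n F b" using F'(1) nonadic b unfolding thompson_F_iff by auto
    then obtain s d where F_near: "\<forall>\<^sub>F x in nhds b. F x = of_nat n powi s * x + d"
      unfolding locally_affine_def by blast
    obtain C C' where G_near: "\<forall>\<^sub>F x in nhds b. G k x = of_nat n ^ k * x + C"
      "\<forall>\<^sub>F x in nhds b. G l x = of_nat n ^ l * x + C'"
      using G_spec by blast
    \<comment> \<open>Closedness makes F affine around b, so the left-hand slope and the right-hand
      slope have to coincide.\<close>
    have "of_nat n powi s = (of_nat n ^ k :: real)"
    proof (rule affine_germs_agree(1)[OF F_near G_near(1), of "b - 1"])
      show "F x = G k x" if "x \<in> closed_segment (b - 1) b" for x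
        using that by (auto simp: closed_segment_eq_real_ivl F_def)
    qed simp
    moreover have "of_nat n powi s = (of_nat n ^ l :: real)"
    proof (rule affine_germs_agree(1)[OF F_near G_near(2), of "b + 1"])
      show "F x = G l x" if "x \<in> closed_segment (b + 1) b" for x
        using that G_kl by (cases "x = b") (auto simp: closed_segment_eq_real_ivl F_def)
    qed simp
    ultimately have "real n ^ k = real n ^ l" by simp
    then show False using kl(1) n by (simp add: power_inject_exp)
  qed
  have "\<phi> ` (adic_rationals n \<inter> {0<..<1}) = adic_rationals m \<inter> {0<..<1}"
  proof
    show "\<phi> ` (adic_rationals n \<inter> {0<..<1}) \<subseteq> adic_rationals m \<inter> {0<..<1}"
      using \<phi>_adic by (auto simp: \<phi>_simps)
    show "adic_rationals m \<inter> {0<..<1} \<subseteq> \<phi> ` (adic_rationals n \<inter> {0<..<1})"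
    proof
      fix y assume "y \<in> adic_rationals m \<inter> {0<..<1}"
      then have "?\<psi> y \<in> adic_rationals n \<inter> {0<..<1}"
        using inv_adic[of "?\<psi> y"] by (simp add: \<phi>_simps)
      then show "y \<in> \<phi> ` (adic_rationals n \<inter> {0<..<1})"
        by (rule rev_image_eqI) (simp add: \<phi>_simps)
    qed
  qed
  then show ?thesis by (auto simp: bij_betw_def inj_on_def \<phi>_simps)
qed

section \<open>Expansions and lifts\<close>

definition digit_sequences :: "nat \<Rightarrow> (nat \<Rightarrow> nat) set" where
  "digit_sequences n = {\<omega>. \<forall>j. \<omega> j < n}"

lemma topspace_cantor_space: "topspace (cantor_space n) = digit_sequences n"
  by (auto simp: cantor_space_def digit_sequences_def)

lemma less_fun_linear:
  fixes f g :: "nat \<Rightarrow> 'a::linorder"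
  assumes "f \<noteq> g"
  shows "less_fun f g \<or> less_fun g f"
proof -
  have ex: "\<exists>k. f k \<noteq> g k" using assms by auto
  define k where "k = (LEAST k. f k \<noteq> g k)"
  have "f k \<noteq> g k" unfolding k_def using ex by (rule LeastI_ex)
  moreover have "f j = g j" if "j < k" for j
    using not_less_Least[of j "\<lambda>k. f k \<noteq> g k"] that by (simp add: k_def)
  ultimately show ?thesis unfolding less_fun_def by (metis linorder_neqE)
qed

context
  fixes n :: nat assumes n: "n \<ge> 2"
begin

section \<open>Values and ambiguity of base-n expansions\<close>

lemma sum_maximal_digits: "(\<Sum>j<k. (of_nat n - 1) / of_nat n ^ Suc j) = 1 - 1 / (of_nat n ^ k :: real)"
proof (induction k)
  case (Suc k)
  have "(of_nat n - 1) / of_nat n ^ Suc k = 1 / of_nat n ^ k - 1 / (of_nat n ^ Suc k :: real)"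
    using n by (simp add: field_simps)
  then show ?case using Suc by simp
qed simp

lemma maximal_digits_sums: "(\<lambda>j. (of_nat n - 1) / of_nat n ^ Suc j) sums (1::real)"
  unfolding sums_def sum_maximal_digits
proof -
  have "(\<lambda>k. (1 / of_nat n) ^ k :: real) \<longlonglongrightarrow> 0"
    using n by (intro LIMSEQ_power_zero) auto
  then have "(\<lambda>k. 1 - (1 / of_nat n) ^ k :: real) \<longlonglongrightarrow> 1 - 0"
    by (intro tendsto_diff tendsto_const)
  then show "(\<lambda>k. 1 - 1 / of_nat n ^ k :: real) \<longlonglongrightarrow> 1"
    by (simp add: power_one_over)
qed

lemma digit_le:
  assumes "\<omega> \<in> digit_sequences n"
  shows "real (\<omega> j) \<le> of_nat n - 1"
proof -
  have "Suc (\<omega> j) \<le> n" using assms by (simp add: digit_sequences_def Suc_leI)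
  then have "real (Suc (\<omega> j)) \<le> real n" by (rule of_nat_mono)
  then show ?thesis by simp
qed

lemma rho_sums:
  assumes "\<omega> \<in> digit_sequences n"
  shows "(\<lambda>j. of_nat (\<omega> j) / of_nat n ^ Suc j) sums rho n \<omega>"
proof -
  have "summable (\<lambda>j. of_nat (\<omega> j) / of_nat n ^ Suc j :: real)"
  proof (rule summable_comparison_test')
    show "summable (\<lambda>j. (of_nat n - 1) / of_nat n ^ Suc j :: real)"
      using maximal_digits_sums by (rule sums_summable)
    fix j
    have "real (\<omega> j) \<le> of_nat n - 1" using digit_le[OF assms] .
    then show "norm (of_nat (\<omega> j) / of_nat n ^ Suc j :: real) \<le> (of_nat n - 1) / of_nat n ^ Suc j"
      using n by (simp add: divide_right_mono)
  qed
  then show ?thesis unfolding rho_def by (rule summable_sums)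
qed

lemma rho_bounds:
  assumes "\<omega> \<in> digit_sequences n"
  shows "rho n \<omega> \<in> {0..1}"
proof -
  have "0 \<le> rho n \<omega>" by (rule sums_le[OF _ sums_zero rho_sums[OF assms]]) simp
  moreover have "rho n \<omega> \<le> 1"
  proof (rule sums_le[OF _ rho_sums[OF assms] maximal_digits_sums])
    fix j
    have "real (\<omega> j) \<le> of_nat n - 1" using digit_le[OF assms] .
    then show "real (\<omega> j) / of_nat n ^ Suc j \<le> (of_nat n - 1) / of_nat n ^ Suc j"
      by (simp add: divide_right_mono)
  qed
  ultimately show ?thesis by simp
qed

text \<open>Borrow one unit from place i and spread it as digits \<open>n - 1\<close> over all later
  places: the difference of the values becomes a series of nonnegative terms, and equality forces
  each of them to vanish.\<close>

lemma rho_first_difference: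
  assumes mem: "\<omega> \<in> digit_sequences n" "\<omega>' \<in> digit_sequences n"
    and i: "\<omega> i < \<omega>' i" "\<And>j. j < i \<Longrightarrow> \<omega> j = \<omega>' j"
  shows "rho n \<omega> \<le> rho n \<omega>'"
    and "rho n \<omega> = rho n \<omega>' \<Longrightarrow> j > i \<Longrightarrow> \<omega> j = n - 1 \<and> \<omega>' j = 0"
proof -
  \<comment> \<open>The two corrections cancel in the sum, because the maximal digits after place i
    add up to one unit of place i.\<close>
  define d :: "nat \<Rightarrow> real" where "d j = real (\<omega>' j) - real (\<omega> j) + (if j > i then of_nat n - 1 else 0)
    - (if j = i then 1 else 0)" for j
  let ?max = "\<lambda>j. (of_nat n - 1) / of_nat n ^ Suc j :: real"
  have "(\<lambda>j. ?max j - (if j \<in> {..<Suc i} then ?max j else 0)) sums (1 - (1 - 1 / of_nat n ^ Suc i))"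
    using sums_diff[OF maximal_digits_sums sums_If_finite_set[of "{..<Suc i}" ?max]]
    unfolding sum_maximal_digits by simp
  then have tail: "(\<lambda>j. ?max j - (if j \<in> {..<Suc i} then ?max j else 0)) sums (1 / of_nat n ^ Suc i)"
    by simp
  have "(\<lambda>j. (of_nat (\<omega>' j) / of_nat n ^ Suc j - of_nat (\<omega> j) / of_nat n ^ Suc j)
      + (?max j - (if j \<in> {..<Suc i} then ?max j else 0)) - (if j = i then 1 / of_nat n ^ Suc j else 0))
      sums (rho n \<omega>' - rho n \<omega> + 1 / of_nat n ^ Suc i - 1 / of_nat n ^ Suc i)"
    by (intro sums_diff sums_add rho_sums mem tail sums_single)
  moreover have "(\<lambda>j. (of_nat (\<omega>' j) / of_nat n ^ Suc j - of_nat (\<omega> j) / of_nat n ^ Suc j)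
      + (?max j - (if j \<in> {..<Suc i} then ?max j else 0)) - (if j = i then 1 / of_nat n ^ Suc j else 0))
      = (\<lambda>j. d j / of_nat n ^ Suc j)"
    by (rule ext) (auto simp: d_def diff_divide_distrib add_divide_distrib)
  ultimately have d_sums: "(\<lambda>j. d j / of_nat n ^ Suc j) sums (rho n \<omega>' - rho n \<omega>)" by simp
  note digit_le = digit_le[OF mem(1)]
  have "d j \<ge> 0" for j
    using i digit_le[of j] by (cases "j < i"; cases "j = i") (auto simp: d_def)
  then have nonneg: "0 \<le> d j / of_nat n ^ Suc j" for j by simp
  show "rho n \<omega> \<le> rho n \<omega>'"
    using sums_le[OF nonneg sums_zero d_sums] by simp
  assume eq: "rho n \<omega> = rho n \<omega>'" and j: "j > i"
  have "d j / of_nat n ^ Suc j = 0"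
    using suminf_eq_zero_iff[OF sums_summable[OF d_sums] nonneg] sums_unique[OF d_sums] eq by simp
  then have "real (\<omega>' j) + (of_nat n - 1 - real (\<omega> j)) = 0" using n j by (simp add: d_def)
  then have *: "real (\<omega>' j) = 0" "real (Suc (\<omega> j)) = real n" using digit_le[of j] by simp_all
  then have "Suc (\<omega> j) = n" by (simp only: of_nat_eq_iff)
  then show "\<omega> j = n - 1 \<and> \<omega>' j = 0" using *(1) by auto
qed

lemma rho_mono:
  assumes "\<omega> \<in> digit_sequences n" "\<omega>' \<in> digit_sequences n" "less_fun \<omega> \<omega>'"
  shows "rho n \<omega> \<le> rho n \<omega>'"
  using assms rho_first_difference(1) by (auto elim!: less_funE)

text \<open>The larger expansion ends in zeros, so its value is a finite sum. Its digit at the first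
  difference is positive, and finitely many digits cannot reach 1.\<close>

lemma rho_eq_adic:
  assumes mem: "\<omega> \<in> digit_sequences n" "\<omega>' \<in> digit_sequences n"
    and less: "less_fun \<omega> \<omega>'" and eq: "rho n \<omega> = rho n \<omega>'"
  shows "rho n \<omega> \<in> adic_rationals n \<inter> {0<..<1}"
proof -
  obtain i where i: "\<omega> i < \<omega>' i" "\<And>j. j < i \<Longrightarrow> \<omega> j = \<omega>' j"
    using less by (auto elim: less_funE)
  let ?t = "\<lambda>j. real (\<omega>' j) / of_nat n ^ Suc j"
  have "?t sums sum ?t {..<Suc i}"
    by (rule sums_finite) (use rho_first_difference(2)[OF mem i eq] in auto)
  then have rho: "rho n \<omega> = sum ?t {..<Suc i}"
    using eq rho_sums[OF mem(2)] sums_unique2 by metis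
  have n0: "n > 0" using n by simp
  have "sum ?t J \<in> adic_rationals n" if "finite J" for J
    using that
  proof (induction rule: finite_induct)
    case (insert j J)
    have "?t j \<in> adic_rationals n"
      by (rule adic_divide_power[OF n0 adic_rationals_Ints]) simp
    then show ?case using insert by (simp add: adic_add[OF n0] del: power_Suc)
  qed (simp add: adic_rationals_Ints)
  moreover have "0 < ?t i" using i(1) n by simp
  then have "0 < sum ?t {..<Suc i}" by (intro sum_pos2[of _ i]) auto
  moreover have "sum ?t {..<Suc i} < 1"
  proof -
    have "sum ?t {..<Suc i} \<le> (\<Sum>j<Suc i. (of_nat n - 1) / of_nat n ^ Suc j)"
    proof (rule sum_mono)
      fix j
      have "real (\<omega>' j) \<le> of_nat n - 1" using digit_le[OF mem(2)] .
      then show "?t j \<le> (of_nat n - 1) / of_nat n ^ Suc j" by (simp add: divide_right_mono)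
    qed
    also have "\<dots> < 1" unfolding sum_maximal_digits using n by simp
    finally show ?thesis .
  qed
  ultimately show ?thesis unfolding rho by (intro IntI) (blast, simp)
qed

text \<open>The middle sequence would end in zeros as the larger of one pair and in digits
  \<open>n - 1\<close> as the smaller of the other.\<close>

lemma no_three_expansions:
  assumes "\<omega> \<in> digit_sequences n" "\<omega>' \<in> digit_sequences n" "\<omega>'' \<in> digit_sequences n"
    and "less_fun \<omega> \<omega>'" "less_fun \<omega>' \<omega>''" "rho n \<omega> = rho n \<omega>'" "rho n \<omega>' = rho n \<omega>''"
  shows False
proof -
  obtain i where i: "\<omega> i < \<omega>' i" "\<And>j. j < i \<Longrightarrow> \<omega> j = \<omega>' j"
    using assms(4) by (auto elim: less_funE)
  obtain k where k: "\<omega>' k < \<omega>'' k" "\<And>j. j < k \<Longrightarrow> \<omega>' j = \<omega>'' j"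
    using assms(5) by (auto elim: less_funE)
  have "\<omega>' (Suc (max i k)) = 0" "\<omega>' (Suc (max i k)) = n - 1"
    using rho_first_difference(2)[OF assms(1,2) i assms(6), of "Suc (max i k)"]
      rho_first_difference(2)[OF assms(2,3) k assms(7), of "Suc (max i k)"] by simp_all
  then show False using n by simp
qed

section \<open>Expansions obtained by truncation\<close>

lemma rho_of_approximations:
  fixes A :: "nat \<Rightarrow> int"
  assumes A0: "A 0 = 0" and step: "\<And>k. 0 \<le> A (Suc k) - int n * A k" "\<And>k. A (Suc k) - int n * A k < int n"
    and lim: "(\<lambda>k. of_int (A k) / of_nat n ^ k) \<longlonglongrightarrow> x"
  defines "\<omega> \<equiv> \<lambda>k. nat (A (Suc k) - int n * A k)"
  shows "\<omega> \<in> digit_sequences n" "rho n \<omega> = x"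
proof -
  show mem: "\<omega> \<in> digit_sequences n"
    using step n by (auto simp: \<omega>_def digit_sequences_def nat_less_iff)
  have \<omega>: "real (\<omega> k) = of_int (A (Suc k)) - of_nat n * of_int (A k)" for k
    using step(1)[of k] by (simp add: \<omega>_def)
  \<comment> \<open>The digits are the increments of the numerators, so the partial sums are exactly
    the given approximations.\<close>
  have "(\<Sum>j<k. real (\<omega> j) / of_nat n ^ Suc j) = of_int (A k) / of_nat n ^ k" for k
    using n by (induction k) (auto simp: A0 \<omega> field_simps)
  then have "(\<lambda>j. real (\<omega> j) / of_nat n ^ Suc j) sums x"
    unfolding sums_def using lim by simp
  then show "rho n \<omega> = x" using rho_sums[OF mem] sums_unique2 by blast
qed

lemma approximations_tendsto:
  assumes "\<And>k. \<bar>of_int (A k) - x * of_nat n ^ k\<bar> \<le> (1::real)"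
  shows "(\<lambda>k. of_int (A k) / of_nat n ^ k) \<longlonglongrightarrow> x"
proof (rule LIM_zero_cancel, rule Lim_null_comparison)
  have "(\<lambda>k. (1 / of_nat n) ^ k :: real) \<longlonglongrightarrow> 0"
    using n by (intro LIMSEQ_power_zero) auto
  then show "(\<lambda>k. 1 / of_nat n ^ k :: real) \<longlonglongrightarrow> 0" by (simp add: power_one_over)
  have "\<bar>of_int (A k) / of_nat n ^ k - x\<bar> \<le> 1 / of_nat n ^ k" for k
  proof -
    have "of_int (A k) / of_nat n ^ k - x = (of_int (A k) - x * of_nat n ^ k) / of_nat n ^ k"
      using n by (simp add: field_simps)
    then show ?thesis using assms[of k] n by (simp add: abs_divide divide_right_mono)
  qed
  then show "\<forall>\<^sub>F k in sequentially. norm (of_int (A k) / of_nat n ^ k - x) \<le> 1 / of_nat n ^ k"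
    by simp
qed

text \<open>Two truncations of the scaled point: the largest integer not above it and, in
  \<open>ceiling_digits\<close>, the largest integer strictly below it. They differ precisely when
  the scaled point is an integer, which singles out the adic points.\<close>

definition floor_digits :: "real \<Rightarrow> nat \<Rightarrow> nat" where
  "floor_digits x k = nat (\<lfloor>x * of_nat n ^ Suc k\<rfloor> - int n * \<lfloor>x * of_nat n ^ k\<rfloor>)"

definition ceiling_digits :: "real \<Rightarrow> nat \<Rightarrow> nat" where
  "ceiling_digits x k = nat ((\<lceil>x * of_nat n ^ Suc k\<rceil> - 1) - int n * (\<lceil>x * of_nat n ^ k\<rceil> - 1))"

lemma floor_digit_bounds:
  fixes y :: real
  shows "0 \<le> \<lfloor>y * of_nat n\<rfloor> - int n * \<lfloor>y\<rfloor>" "\<lfloor>y * of_nat n\<rfloor> - int n * \<lfloor>y\<rfloor> < int n"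
proof -
  have "of_nat n * of_int \<lfloor>y\<rfloor> \<le> of_nat n * y" by (intro mult_left_mono) auto
  then have "of_int (int n * \<lfloor>y\<rfloor>) \<le> y * of_nat n" by (simp add: mult.commute)
  then show "0 \<le> \<lfloor>y * of_nat n\<rfloor> - int n * \<lfloor>y\<rfloor>" by linarith
  have "of_nat n * y < of_nat n * (of_int \<lfloor>y\<rfloor> + 1)" using n by (intro mult_strict_left_mono) linarith+
  then have "y * of_nat n < of_int (int n * \<lfloor>y\<rfloor> + int n)" by (simp add: algebra_simps)
  then show "\<lfloor>y * of_nat n\<rfloor> - int n * \<lfloor>y\<rfloor> < int n" by linarith
qed

text \<open>Reflecting y to \<open>- y\<close> replaces a floor digit by its complement to
  \<open>n - 1\<close>.\<close>

lemma ceiling_digit_bounds: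
  fixes y :: real
  shows "0 \<le> (\<lceil>y * of_nat n\<rceil> - 1) - int n * (\<lceil>y\<rceil> - 1)" "(\<lceil>y * of_nat n\<rceil> - 1) - int n * (\<lceil>y\<rceil> - 1) < int n"
proof -
  have *: "\<lceil>z\<rceil> = - \<lfloor>- z\<rfloor>" for z :: real by (rule ceiling_def)
  show "0 \<le> (\<lceil>y * of_nat n\<rceil> - 1) - int n * (\<lceil>y\<rceil> - 1)"
    "(\<lceil>y * of_nat n\<rceil> - 1) - int n * (\<lceil>y\<rceil> - 1) < int n"
    using floor_digit_bounds[of "- y"] n unfolding * by (simp_all add: algebra_simps)
qed

lemma floor_digits:
  assumes "0 \<le> x" "x < 1"
  shows "floor_digits x \<in> digit_sequences n" "rho n (floor_digits x) = x"
proof -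
  let ?A = "\<lambda>k. \<lfloor>x * of_nat n ^ k\<rfloor>"
  have A: "?A 0 = 0" using assms by (simp add: floor_eq_iff)
  have step: "0 \<le> ?A (Suc k) - int n * ?A k" "?A (Suc k) - int n * ?A k < int n" for k
    using floor_digit_bounds[of "x * of_nat n ^ k"] by (simp_all add: mult_ac)
  have lim: "(\<lambda>k. of_int (?A k) / of_nat n ^ k) \<longlonglongrightarrow> x"
    by (rule approximations_tendsto) linarith
  show "floor_digits x \<in> digit_sequences n" "rho n (floor_digits x) = x"
    using rho_of_approximations[OF A step lim] unfolding floor_digits_def by simp_all
qed

lemma ceiling_digits:
  assumes "0 < x" "x \<le> 1"
  shows "ceiling_digits x \<in> digit_sequences n" "rho n (ceiling_digits x) = x"
proof -
  let ?A = "\<lambda>k. \<lceil>x * of_nat n ^ k\<rceil> - 1"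
  have A: "?A 0 = 0" using assms by (simp add: ceiling_eq_iff)
  have step: "0 \<le> ?A (Suc k) - int n * ?A k" "?A (Suc k) - int n * ?A k < int n" for k
    using ceiling_digit_bounds[of "x * of_nat n ^ k"] by (simp_all add: mult_ac)
  have lim: "(\<lambda>k. of_int (?A k) / of_nat n ^ k) \<longlonglongrightarrow> x"
    by (rule approximations_tendsto) linarith
  show "ceiling_digits x \<in> digit_sequences n" "rho n (ceiling_digits x) = x"
    using rho_of_approximations[OF A step lim] unfolding ceiling_digits_def by simp_all
qed

text \<open>Equal digits would keep the floor one below the ceiling at every scale, including the
  scale that clears the denominator.\<close>

lemma floor_digits_neq_ceiling_digits:
  assumes x: "x \<in> adic_rationals n" "0 < x" "x < 1"
  shows "floor_digits x \<noteq> ceiling_digits x"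
proof
  assume eq: "floor_digits x = ceiling_digits x"
  have all: "\<lfloor>x * of_nat n ^ k\<rfloor> = \<lceil>x * of_nat n ^ k\<rceil> - 1" for k
  proof (induction k)
    case 0
    have "\<lfloor>x\<rfloor> = 0" "\<lceil>x\<rceil> = 1" using x by linarith+
    then show ?case by simp
  next
    case (Suc k)
    have "floor_digits x k = ceiling_digits x k" using eq by simp
    then have "\<lfloor>x * of_nat n ^ Suc k\<rfloor> - int n * \<lfloor>x * of_nat n ^ k\<rfloor>
        = (\<lceil>x * of_nat n ^ Suc k\<rceil> - 1) - int n * (\<lceil>x * of_nat n ^ k\<rceil> - 1)"
      using floor_digit_bounds(1)[of "x * of_nat n ^ k"] ceiling_digit_bounds(1)[of "x * of_nat n ^ k"]
      unfolding floor_digits_def ceiling_digits_def by (simp add: mult_ac)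
    then show ?case using Suc by simp
  qed
  obtain k where "x * of_nat n ^ k \<in> \<int>"
    using x(1) n by (auto simp: adic_rationals_iff)
  then have "\<lfloor>x * of_nat n ^ k\<rfloor> = \<lceil>x * of_nat n ^ k\<rceil>" by (auto elim!: Ints_cases)
  then show False using all[of k] by simp
qed

text \<open>
  A point has at most two expansions, so \<open>(rho n \<omega>, is_upper \<omega>)\<close> determines \<open>\<omega>\<close>, and the
  lexicographic order of the expansions is that of these pairs. A lift transports the first
  component by \<open>\<phi>\<close> and keeps the second.
\<close>

definition is_upper :: "(nat \<Rightarrow> nat) \<Rightarrow> bool" where
  "is_upper \<omega> \<longleftrightarrow> (\<exists>\<omega>'\<in>digit_sequences n. less_fun \<omega>' \<omega> \<and> rho n \<omega>' = rho n \<omega>)"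

lemma is_upper_adic:
  assumes "\<omega> \<in> digit_sequences n" "is_upper \<omega>"
  shows "rho n \<omega> \<in> adic_rationals n \<inter> {0<..<1}"
proof -
  obtain \<omega>' where "\<omega>' \<in> digit_sequences n" "less_fun \<omega>' \<omega>" "rho n \<omega>' = rho n \<omega>"
    using assms(2) unfolding is_upper_def by blast
  then show ?thesis using rho_eq_adic[of \<omega>' \<omega>] assms(1) by simp
qed

text \<open>Any expansion below \<omega> with the same value would be a third one.\<close>

lemma not_is_upper_if_less:
  assumes "\<omega> \<in> digit_sequences n" "\<omega>' \<in> digit_sequences n" "less_fun \<omega> \<omega>'" "rho n \<omega> = rho n \<omega>'"
  shows "\<not> is_upper \<omega>" "is_upper \<omega>'"
  using assms no_three_expansions[OF _ assms(1,2) _ assms(3) _ assms(4)] unfolding is_upper_def by auto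

lemma expansion_unique:
  assumes "\<omega> \<in> digit_sequences n" "\<omega>' \<in> digit_sequences n" "rho n \<omega> = rho n \<omega>'"
    and "is_upper \<omega> \<longleftrightarrow> is_upper \<omega>'"
  shows "\<omega> = \<omega>'"
proof (rule ccontr)
  assume "\<omega> \<noteq> \<omega>'"
  then consider "less_fun \<omega> \<omega>'" | "less_fun \<omega>' \<omega>" using less_fun_linear by blast
  then show False
    using not_is_upper_if_less[OF assms(1,2)] not_is_upper_if_less[OF assms(2,1)] assms(3,4) by cases auto
qed

lemma expansion_exists:
  assumes x: "x \<in> {0..1}" and u: "u \<Longrightarrow> x \<in> adic_rationals n \<inter> {0<..<1}"
  shows "\<exists>\<omega>\<in>digit_sequences n. rho n \<omega> = x \<and> (is_upper \<omega> \<longleftrightarrow> u)"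
proof (cases u)
  case True
  then have "x \<in> adic_rationals n" "0 < x" "x < 1" using u by auto
  then have "floor_digits x \<noteq> ceiling_digits x"
    and "floor_digits x \<in> digit_sequences n" "ceiling_digits x \<in> digit_sequences n"
    and "rho n (floor_digits x) = x" "rho n (ceiling_digits x) = x"
    using floor_digits ceiling_digits floor_digits_neq_ceiling_digits by auto
  then show ?thesis
    using True less_fun_linear[of "floor_digits x" "ceiling_digits x"]
      not_is_upper_if_less(2)[of "floor_digits x" "ceiling_digits x"]
      not_is_upper_if_less(2)[of "ceiling_digits x" "floor_digits x"] by auto
next
  case False
  \<comment> \<open>The floor truncation covers every x below 1, and the ceiling truncation the
    remaining end point.\<close>
  have "\<exists>\<omega>\<in>digit_sequences n. rho n \<omega> = x"
    using x floor_digits[of x] ceiling_digits[of x] by (cases "x < 1") auto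
  then obtain \<omega> where \<omega>: "\<omega> \<in> digit_sequences n" "rho n \<omega> = x" by blast
  show ?thesis
  proof (cases "is_upper \<omega>")
    case True
    then obtain \<omega>' where "\<omega>' \<in> digit_sequences n" "less_fun \<omega>' \<omega>" "rho n \<omega>' = rho n \<omega>"
      unfolding is_upper_def by blast
    then show ?thesis using \<omega> False not_is_upper_if_less(1)[of \<omega>' \<omega>] by auto
  qed (use \<omega> False in auto)
qed

section \<open>Lexicographic order and the product topology\<close>

lemma openin_cylinder: "openin (cantor_space n) {\<omega> \<in> digit_sequences n. \<forall>j<k. \<omega> j = w j}"
proof (induction k)
  case 0
  then show ?case using openin_topspace[of "cantor_space n"] by (simp add: topspace_cantor_space)
next
  case (Suc k)
  have "continuous_map (cantor_space n) (discrete_topology {..<n}) (\<lambda>\<omega>. \<omega> k)"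
    unfolding cantor_space_def by (rule continuous_map_product_projection) simp
  then have "openin (cantor_space n) {\<omega> \<in> topspace (cantor_space n). \<omega> k \<in> {w k} \<inter> {..<n}}"
    by (rule openin_continuous_map_preimage) simp
  from openin_Int[OF Suc this] show ?case
    by (rule back_subst) (auto simp: topspace_cantor_space digit_sequences_def less_Suc_eq)
qed

text \<open>A strict comparison is decided at the first differing digit, so it persists on the
  cylinder of the prefix up to there.\<close>

lemma openin_lex_rays:
  "openin (cantor_space n) {\<omega> \<in> digit_sequences n. less_fun \<omega> \<eta>}" (is "openin _ ?L")
  "openin (cantor_space n) {\<omega> \<in> digit_sequences n. less_fun \<eta> \<omega>}" (is "openin _ ?R")
proof -
  have "\<exists>U. openin (cantor_space n) U \<and> \<omega> \<in> U \<and> U \<subseteq> ?L" if "\<omega> \<in> ?L" for \<omega>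
  proof -
    obtain k where k: "\<omega> k < \<eta> k" "\<And>j. j < k \<Longrightarrow> \<omega> j = \<eta> j" using \<open>\<omega> \<in> ?L\<close> by (auto elim: less_funE)
    show ?thesis
      using openin_cylinder[of "Suc k" \<omega>] k \<open>\<omega> \<in> ?L\<close>
      by (intro exI[of _ "{\<omega>' \<in> digit_sequences n. \<forall>j<Suc k. \<omega>' j = \<omega> j}"])
        (auto simp: less_Suc_eq intro!: less_funI exI[of _ k])
  qed
  then show "openin (cantor_space n) ?L" by (subst openin_subopen) blast
  have "\<exists>U. openin (cantor_space n) U \<and> \<omega> \<in> U \<and> U \<subseteq> ?R" if "\<omega> \<in> ?R" for \<omega>
  proof -
    obtain k where k: "\<eta> k < \<omega> k" "\<And>j. j < k \<Longrightarrow> \<eta> j = \<omega> j" using \<open>\<omega> \<in> ?R\<close> by (auto elim: less_funE)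
    show ?thesis
      using openin_cylinder[of "Suc k" \<omega>] k \<open>\<omega> \<in> ?R\<close>
      by (intro exI[of _ "{\<omega>' \<in> digit_sequences n. \<forall>j<Suc k. \<omega>' j = \<omega> j}"])
        (auto simp: less_Suc_eq intro!: less_funI exI[of _ k])
  qed
  then show "openin (cantor_space n) ?R" by (subst openin_subopen) blast
qed

end

lemma monotone_on_less_fun_iff:
  fixes \<Phi> :: "(nat \<Rightarrow> 'a::linorder) \<Rightarrow> nat \<Rightarrow> 'b::linorder"
  assumes "monotone_on D less_fun less_fun \<Phi>" "\<omega> \<in> D" "\<eta> \<in> D"
  shows "less_fun (\<Phi> \<omega>) (\<Phi> \<eta>) \<longleftrightarrow> less_fun \<omega> \<eta>"
proof
  assume less: "less_fun (\<Phi> \<omega>) (\<Phi> \<eta>)"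
  show "less_fun \<omega> \<eta>"
  proof (rule ccontr)
    assume "\<not> less_fun \<omega> \<eta>"
    then have "\<omega> = \<eta> \<or> less_fun \<eta> \<omega>" using less_fun_linear by blast
    then have "\<Phi> \<omega> = \<Phi> \<eta> \<or> less_fun (\<Phi> \<eta>) (\<Phi> \<omega>)"
      using monotone_onD[OF assms(1,3,2)] by blast
    then show False using less less_fun_asym less_fun_irrefl by metis
  qed
qed (use assms in \<open>auto dest: monotone_onD\<close>)

text \<open>
  Cylinders are closed lexicographic intervals; since each level has finitely many of them,
  closedness of their preimages is enough for continuity.
\<close>

lemma continuous_lex_isomorphism:
  assumes n: "n \<ge> 2" and m: "m > 0"
    and maps: "\<Phi> \<in> digit_sequences n \<rightarrow> digit_sequences m" "\<Psi> \<in> digit_sequences m \<rightarrow> digit_sequences n"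
    and inverse: "\<And>\<eta>. \<eta> \<in> digit_sequences m \<Longrightarrow> \<Phi> (\<Psi> \<eta>) = \<eta>"
    and mono: "monotone_on (digit_sequences n) less_fun less_fun \<Phi>"
  shows "continuous_map (cantor_space n) (cantor_space m) \<Phi>"
proof -
  have closed_cylinder: "closedin (cantor_space n) {\<omega> \<in> digit_sequences n. \<forall>j\<le>i. \<Phi> \<omega> j = w j}"
    if w: "\<And>j. j \<le> i \<Longrightarrow> w j < m" for i w
  proof -
    \<comment> \<open>\<open>lo\<close> and \<open>hi\<close> are the least and the greatest digit
      sequence with prefix w.\<close>
    define lo where "lo j = (if j \<le> i then w j else 0)" for j
    define hi where "hi j = (if j \<le> i then w j else m - 1)" for j
    have mem: "lo \<in> digit_sequences m" "hi \<in> digit_sequences m"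
      using w m by (auto simp: lo_def hi_def digit_sequences_def)
    have iff: "(\<forall>j\<le>i. \<eta> j = w j) \<longleftrightarrow> \<not> less_fun \<eta> lo \<and> \<not> less_fun hi \<eta>"
      if "\<eta> \<in> digit_sequences m" for \<eta>
    proof
      assume agree: "\<forall>j\<le>i. \<eta> j = w j"
      have "\<eta> k < m" for k using that by (simp add: digit_sequences_def)
      then have "\<eta> k \<le> m - 1" for k by (simp add: Suc_leI le_diff_conv2 m)
      then have "\<not> \<eta> k < lo k" "\<not> hi k < \<eta> k" for k using agree by (auto simp: lo_def hi_def not_less)
      then show "\<not> less_fun \<eta> lo \<and> \<not> less_fun hi \<eta>" by (auto simp: less_fun_def)
    next
      assume between: "\<not> less_fun \<eta> lo \<and> \<not> less_fun hi \<eta>"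
      have "\<eta> j = w j" if "j \<le> i" for j
        using that
      proof (induction j rule: less_induct)
        case (less j)
        then have before: "\<eta> k = lo k \<and> hi k = \<eta> k" if "k < j" for k using that by (simp add: lo_def hi_def)
        have "lo j = w j" "hi j = w j" using less.prems by (simp_all add: lo_def hi_def)
        moreover have "\<not> \<eta> j < lo j" "\<not> hi j < \<eta> j" using between before by (auto simp: less_fun_def)
        ultimately show ?case by simp
      qed
      then show "\<forall>j\<le>i. \<eta> j = w j" by blast
    qed
    have "less_fun (\<Phi> \<omega>) lo \<longleftrightarrow> less_fun \<omega> (\<Psi> lo)" "less_fun hi (\<Phi> \<omega>) \<longleftrightarrow> less_fun (\<Psi> hi) \<omega>"
      if "\<omega> \<in> digit_sequences n" for \<omega>
      using monotone_on_less_fun_iff[OF mono that, of "\<Psi> lo"] monotone_on_less_fun_iff[OF mono _ that, of "\<Psi> hi"]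
        mem maps(2) inverse by (auto simp: Pi_iff)
    \<comment> \<open>Pulling \<open>lo\<close> and \<open>hi\<close> back by \<Psi> exhibits the
      preimage as the complement of two open rays.\<close>
    then have "{\<omega> \<in> digit_sequences n. \<forall>j\<le>i. \<Phi> \<omega> j = w j} =
        topspace (cantor_space n) - ({\<omega> \<in> digit_sequences n. less_fun \<omega> (\<Psi> lo)} \<union> {\<omega> \<in> digit_sequences n. less_fun (\<Psi> hi) \<omega>})"
      using iff maps(1) by (auto simp: topspace_cantor_space Pi_iff)
    then show ?thesis
      using openin_lex_rays[OF n] by (simp add: openin_Un closedin_diff)
  qed
  have "continuous_map (cantor_space n) (discrete_topology {..<m}) (\<lambda>\<omega>. \<Phi> \<omega> i)" for i
    unfolding continuous_map_closedin
  proof (intro conjI allI impI)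
    show "(\<lambda>\<omega>. \<Phi> \<omega> i) \<in> topspace (cantor_space n) \<rightarrow> topspace (discrete_topology {..<m})"
      using maps(1) by (auto simp: topspace_cantor_space digit_sequences_def Pi_iff)
    fix C assume "closedin (discrete_topology {..<m}) C"
    let ?W = "{w \<in> PiE {..i} (\<lambda>_. {..<m}). w i \<in> C}"
    have "{\<omega> \<in> topspace (cantor_space n). \<Phi> \<omega> i \<in> C} =
        (\<Union>w\<in>?W. {\<omega> \<in> digit_sequences n. \<forall>j\<le>i. \<Phi> \<omega> j = w j})"
    proof (intro equalityI subsetI)
      fix \<omega> assume \<omega>: "\<omega> \<in> {\<omega> \<in> topspace (cantor_space n). \<Phi> \<omega> i \<in> C}"
      then have W: "restrict (\<Phi> \<omega>) {..i} \<in> ?W"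
        using maps(1) by (auto simp: topspace_cantor_space digit_sequences_def Pi_iff)
      then show "\<omega> \<in> (\<Union>w\<in>?W. {\<omega> \<in> digit_sequences n. \<forall>j\<le>i. \<Phi> \<omega> j = w j})"
        using \<omega> by (intro UN_I[OF W]) (auto simp: topspace_cantor_space)
    qed (auto simp: topspace_cantor_space)
    moreover have "finite ?W" by (intro finite_subset[OF _ finite_PiE[of "{..i}" "\<lambda>_. {..<m}"]]) auto
    ultimately show "closedin (cantor_space n) {\<omega> \<in> topspace (cantor_space n). \<Phi> \<omega> i \<in> C}"
      by (auto intro!: closedin_Union closed_cylinder)
  qed
  then show ?thesis
    unfolding cantor_space_def[of m] by (simp add: continuous_map_componentwise_UNIV)
qed

section \<open>Lifts from matched adic points\<close>

lemma adic_lift_exists: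
  assumes n: "n \<ge> 2" and m: "m \<ge> 2" and \<phi>: "\<phi> \<in> homeo_plus"
    and adic: "\<phi> ` (adic_rationals n \<inter> {0<..<1}) \<subseteq> adic_rationals m \<inter> {0<..<1}"
  shows "\<exists>\<Phi>. \<forall>\<omega>\<in>digit_sequences n. \<Phi> \<omega> \<in> digit_sequences m \<and> rho m (\<Phi> \<omega>) = \<phi> (rho n \<omega>) \<and>
    (is_upper m (\<Phi> \<omega>) \<longleftrightarrow> is_upper n \<omega>)"
proof (rule bchoice, rule ballI)
  fix \<omega> assume \<omega>: "\<omega> \<in> digit_sequences n"
  have "\<phi> (rho n \<omega>) \<in> {0..1}"
    using rho_bounds[OF n \<omega>] by (simp add: homeo_plus_0_le_iff[OF \<phi>] homeo_plus_le_1_iff[OF \<phi>])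
  \<comment> \<open>An upper expansion exists only over an adic point of the open interval, so the
    flag can be transported as soon as \<phi> sends such points to such points.\<close>
  moreover have "\<phi> (rho n \<omega>) \<in> adic_rationals m \<inter> {0<..<1}" if "is_upper n \<omega>"
    using adic is_upper_adic[OF n \<omega> that] by blast
  ultimately show "\<exists>\<eta>. \<eta> \<in> digit_sequences m \<and> rho m \<eta> = \<phi> (rho n \<omega>) \<and> (is_upper m \<eta> \<longleftrightarrow> is_upper n \<omega>)"
    using expansion_exists[OF m] by blast
qed

text \<open>A failure of monotonicity forces equal values, since \<phi> reflects the order; the
  larger argument then carries the upper flag, and so must its image.\<close>

lemma adic_lift_monotone:
  assumes n: "n \<ge> 2" and m: "m \<ge> 2" and \<phi>: "\<phi> \<in> homeo_plus"
    and \<Phi>: "\<And>\<omega>. \<omega> \<in> digit_sequences n \<Longrightarrow> \<Phi> \<omega> \<in> digit_sequences m \<and> rho m (\<Phi> \<omega>) = \<phi> (rho n \<omega>) \<and>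
      (is_upper m (\<Phi> \<omega>) \<longleftrightarrow> is_upper n \<omega>)"
  shows "monotone_on (digit_sequences n) less_fun less_fun \<Phi>"
proof (rule monotone_onI)
  fix \<omega> \<eta> assume mem: "\<omega> \<in> digit_sequences n" "\<eta> \<in> digit_sequences n" and less: "less_fun \<omega> \<eta>"
  have \<Phi>_mem: "\<Phi> \<omega> \<in> digit_sequences m" "\<Phi> \<eta> \<in> digit_sequences m" using \<Phi> mem by auto
  have le: "rho n \<omega> \<le> rho n \<eta>" using rho_mono[OF n mem less] .
  show "less_fun (\<Phi> \<omega>) (\<Phi> \<eta>)"
  proof (rule ccontr)
    assume "\<not> less_fun (\<Phi> \<omega>) (\<Phi> \<eta>)"
    then consider "\<Phi> \<omega> = \<Phi> \<eta>" | "less_fun (\<Phi> \<eta>) (\<Phi> \<omega>)" using less_fun_linear by blast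
    then have ge: "rho m (\<Phi> \<eta>) \<le> rho m (\<Phi> \<omega>)" by cases (use rho_mono[OF m] \<Phi>_mem in auto)
    then have "rho n \<eta> \<le> rho n \<omega>" using \<Phi> mem by (simp add: homeo_plus_le_iff[OF \<phi>])
    then have eq: "rho n \<omega> = rho n \<eta>" using le by simp
    then have "\<not> is_upper n \<omega>" "is_upper n \<eta>" using not_is_upper_if_less[OF n mem less] by auto
    then have upper: "\<not> is_upper m (\<Phi> \<omega>)" "is_upper m (\<Phi> \<eta>)" using \<Phi> mem by auto
    then have "\<Phi> \<omega> \<noteq> \<Phi> \<eta>" by metis
    then have "less_fun (\<Phi> \<eta>) (\<Phi> \<omega>)"
      using \<open>\<not> less_fun (\<Phi> \<omega>) (\<Phi> \<eta>)\<close> less_fun_linear[of "\<Phi> \<omega>" "\<Phi> \<eta>"] by auto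
    then have "is_upper m (\<Phi> \<omega>)"
      using not_is_upper_if_less(2)[OF m \<Phi>_mem(2,1)] \<Phi> mem eq by simp
    then show False using upper by simp
  qed
qed

text \<open>The same construction is applied to \<phi> and to its inverse. Because value and flag
  determine an expansion, the two resulting maps are mutually inverse.\<close>

lemma lift_exists_if_bij:
  assumes n: "n \<ge> 2" and m: "m \<ge> 2" and \<phi>: "\<phi> \<in> homeo_plus"
    and bij: "bij_betw \<phi> (adic_rationals n \<inter> {0<..<1}) (adic_rationals m \<inter> {0<..<1})"
  shows "\<exists>\<Phi>. is_lift n m \<phi> \<Phi> \<and> lex_preserving n \<Phi>"
proof -
  let ?\<psi> = "inv_into UNIV \<phi>"
  have \<psi>: "?\<psi> \<in> homeo_plus" by (rule inv_homeo_plus[OF \<phi>])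
  have img: "\<phi> ` (adic_rationals n \<inter> {0<..<1}) = adic_rationals m \<inter> {0<..<1}"
    using bij by (simp add: bij_betw_def)
  \<comment> \<open>Surjectivity onto the m-adic points is what makes the inverse eligible for the
    same construction.\<close>
  have "?\<psi> ` (adic_rationals m \<inter> {0<..<1}) \<subseteq> adic_rationals n \<inter> {0<..<1}"
    unfolding img[symmetric] by (auto simp: homeo_plus_inv_f[OF \<phi>])
  then obtain \<Psi> where \<Psi>: "\<forall>\<omega>\<in>digit_sequences m. \<Psi> \<omega> \<in> digit_sequences n \<and> rho n (\<Psi> \<omega>) = ?\<psi> (rho m \<omega>) \<and>
    (is_upper n (\<Psi> \<omega>) \<longleftrightarrow> is_upper m \<omega>)"
    using adic_lift_exists[OF m n \<psi>] by blast
  obtain \<Phi> where \<Phi>: "\<forall>\<omega>\<in>digit_sequences n. \<Phi> \<omega> \<in> digit_sequences m \<and> rho m (\<Phi> \<omega>) = \<phi> (rho n \<omega>) \<and>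
    (is_upper m (\<Phi> \<omega>) \<longleftrightarrow> is_upper n \<omega>)"
    using adic_lift_exists[OF n m \<phi>] img by blast
  have \<Psi>\<Phi>: "\<Psi> (\<Phi> \<omega>) = \<omega>" if "\<omega> \<in> digit_sequences n" for \<omega>
    using expansion_unique[OF n, of "\<Psi> (\<Phi> \<omega>)" \<omega>] \<Phi> \<Psi> that by (simp add: homeo_plus_inv_f[OF \<phi>])
  have \<Phi>\<Psi>: "\<Phi> (\<Psi> \<omega>) = \<omega>" if "\<omega> \<in> digit_sequences m" for \<omega>
    using expansion_unique[OF m, of "\<Phi> (\<Psi> \<omega>)" \<omega>] \<Phi> \<Psi> that by (simp add: homeo_plus_f_inv[OF \<phi>])
  have mono: "monotone_on (digit_sequences n) less_fun less_fun \<Phi>"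
    by (rule adic_lift_monotone[OF n m \<phi>]) (use \<Phi> in blast)
  have mono': "monotone_on (digit_sequences m) less_fun less_fun \<Psi>"
    by (rule adic_lift_monotone[OF m n \<psi>]) (use \<Psi> in blast)
  have "continuous_map (cantor_space n) (cantor_space m) \<Phi>"
    by (rule continuous_lex_isomorphism[OF n _ _ _ \<Phi>\<Psi> mono]) (use m \<Phi> \<Psi> in auto)
  moreover have "continuous_map (cantor_space m) (cantor_space n) \<Psi>"
    by (rule continuous_lex_isomorphism[OF m _ _ _ \<Psi>\<Phi> mono']) (use n \<Phi> \<Psi> in auto)
  ultimately have "homeomorphic_maps (cantor_space n) (cantor_space m) \<Phi> \<Psi>"
    using \<Psi>\<Phi> \<Phi>\<Psi> by (simp add: homeomorphic_maps_def topspace_cantor_space)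
  then have "is_lift n m \<phi> \<Phi>"
    unfolding is_lift_def homeomorphic_map_maps using \<Phi> by (auto simp: topspace_cantor_space)
  then show ?thesis using mono by (auto simp: lex_preserving_def topspace_cantor_space)
qed

section \<open>Matched adic points from lifts\<close>

lemma adic_iff_two_expansions:
  assumes n: "n \<ge> 2"
  shows "x \<in> adic_rationals n \<inter> {0<..<1} \<longleftrightarrow>
    (\<exists>\<omega>\<in>digit_sequences n. \<exists>\<omega>'\<in>digit_sequences n. \<omega> \<noteq> \<omega>' \<and> rho n \<omega> = x \<and> rho n \<omega>' = x)"
proof
  assume "x \<in> adic_rationals n \<inter> {0<..<1}"
  then have x: "x \<in> adic_rationals n" "0 < x" "x < 1" by auto
  show "\<exists>\<omega>\<in>digit_sequences n. \<exists>\<omega>'\<in>digit_sequences n. \<omega> \<noteq> \<omega>' \<and> rho n \<omega> = x \<and> rho n \<omega>' = x"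
  proof (intro bexI conjI)
    show "floor_digits n x \<noteq> ceiling_digits n x" by (rule floor_digits_neq_ceiling_digits[OF n x])
  qed (use floor_digits[OF n, of x] ceiling_digits[OF n, of x] x in auto)
next
  assume "\<exists>\<omega>\<in>digit_sequences n. \<exists>\<omega>'\<in>digit_sequences n. \<omega> \<noteq> \<omega>' \<and> rho n \<omega> = x \<and> rho n \<omega>' = x"
  then obtain \<omega> \<omega>' where \<omega>: "\<omega> \<in> digit_sequences n" "\<omega>' \<in> digit_sequences n" "\<omega> \<noteq> \<omega>'"
    "rho n \<omega> = x" "rho n \<omega>' = x" by blast
  from less_fun_linear[OF \<omega>(3)] show "x \<in> adic_rationals n \<inter> {0<..<1}"
  proof
    assume "less_fun \<omega> \<omega>'"
    from rho_eq_adic[OF n \<omega>(1,2) this] show ?thesis unfolding \<omega>(4,5) by blast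
  next
    assume "less_fun \<omega>' \<omega>"
    from rho_eq_adic[OF n \<omega>(2,1) this] show ?thesis unfolding \<omega>(4,5) by blast
  qed
qed

text \<open>A bijection lying over \<phi> carries the expansions of x onto the expansions of
  \<open>\<phi> x\<close>, so having two of them is preserved in both directions.\<close>

lemma bij_if_lift:
  assumes n: "n \<ge> 2" and m: "m \<ge> 2" and \<phi>: "\<phi> \<in> homeo_plus" and lift: "is_lift n m \<phi> \<Phi>"
  shows "bij_betw \<phi> (adic_rationals n \<inter> {0<..<1}) (adic_rationals m \<inter> {0<..<1})"
proof -
  have homeo: "homeomorphic_map (cantor_space n) (cantor_space m) \<Phi>"
    and rho: "\<And>\<omega>. \<omega> \<in> digit_sequences n \<Longrightarrow> rho m (\<Phi> \<omega>) = \<phi> (rho n \<omega>)"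
    using lift by (auto simp: is_lift_def topspace_cantor_space)
  have inj: "inj_on \<Phi> (digit_sequences n)" and surj: "\<Phi> ` digit_sequences n = digit_sequences m"
    using homeomorphic_imp_injective_map[OF homeo] homeomorphic_imp_surjective_map[OF homeo]
    by (simp_all add: topspace_cantor_space)
  have "\<phi> ` (adic_rationals n \<inter> {0<..<1}) = adic_rationals m \<inter> {0<..<1}"
  proof
    show "\<phi> ` (adic_rationals n \<inter> {0<..<1}) \<subseteq> adic_rationals m \<inter> {0<..<1}"
    proof
      fix y assume "y \<in> \<phi> ` (adic_rationals n \<inter> {0<..<1})"
      then obtain x where x: "y = \<phi> x" "x \<in> adic_rationals n \<inter> {0<..<1}" by blast
      from adic_iff_two_expansions[OF n, THEN iffD1, OF x(2)] obtain \<omega> \<omega>' where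
        \<omega>: "\<omega> \<in> digit_sequences n" "\<omega>' \<in> digit_sequences n" "\<omega> \<noteq> \<omega>'" "rho n \<omega> = x" "rho n \<omega>' = x"
        by blast
      show "y \<in> adic_rationals m \<inter> {0<..<1}"
      proof (rule adic_iff_two_expansions[OF m, THEN iffD2], intro bexI conjI)
        show "\<Phi> \<omega> \<noteq> \<Phi> \<omega>'" using inj \<omega>(1-3) by (simp add: inj_on_eq_iff)
        show "\<Phi> \<omega> \<in> digit_sequences m" "\<Phi> \<omega>' \<in> digit_sequences m" using surj \<omega>(1,2) by blast+
        show "rho m (\<Phi> \<omega>) = y" "rho m (\<Phi> \<omega>') = y" using rho \<omega> x(1) by simp_all
      qed
    qed
    show "adic_rationals m \<inter> {0<..<1} \<subseteq> \<phi> ` (adic_rationals n \<inter> {0<..<1})"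
    proof
      fix y assume y: "y \<in> adic_rationals m \<inter> {0<..<1}"
      from adic_iff_two_expansions[OF m, THEN iffD1, OF y] obtain \<eta> \<eta>' where
        \<eta>: "\<eta> \<in> digit_sequences m" "\<eta>' \<in> digit_sequences m" "\<eta> \<noteq> \<eta>'" "rho m \<eta> = y" "rho m \<eta>' = y"
        by blast
      obtain \<omega> \<omega>' where \<omega>: "\<omega> \<in> digit_sequences n" "\<omega>' \<in> digit_sequences n" "\<eta> = \<Phi> \<omega>" "\<eta>' = \<Phi> \<omega>'"
        using \<eta>(1,2) unfolding surj[symmetric] by blast
      then have \<omega>': "\<omega> \<noteq> \<omega>'" "rho n \<omega>' = rho n \<omega>" "y = \<phi> (rho n \<omega>)"
        using \<eta> rho[OF \<omega>(1)] rho[OF \<omega>(2)] homeo_plus_eq_iff[OF \<phi>, of "rho n \<omega>'" "rho n \<omega>"] by auto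
      then show "y \<in> \<phi> ` (adic_rationals n \<inter> {0<..<1})"
        using adic_iff_two_expansions[OF n, THEN iffD2, of "rho n \<omega>"] \<omega>(1,2) by blast
    qed
  qed
  then show ?thesis by (auto simp: bij_betw_def inj_on_def homeo_plus_eq_iff[OF \<phi>])
qed

theorem corollary2p28:
  fixes n m :: nat and \<phi> :: "real \<Rightarrow> real"
  assumes "n \<ge> 2" and "m \<ge> 2"
    and "\<phi> \<in> homeo_plus"
    and "subgroup (conj_F \<phi> n) (thompson_group m)"
  shows "(closed_in_F m (conj_F \<phi> n) \<longleftrightarrow>
            bij_betw \<phi> (adic_rationals n \<inter> {0<..<1}) (adic_rationals m \<inter> {0<..<1}))
       \<and> (closed_in_F m (conj_F \<phi> n) \<longleftrightarrow>
            (\<exists>\<Phi>. is_lift n m \<phi> \<Phi> \<and> lex_preserving n \<Phi>))"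
proof -
  have H: "conj_F \<phi> n \<subseteq> thompson_F m"
    using subgroup.subset[OF assms(4)] by (simp add: thompson_group_def)
  have "closed_in_F m (conj_F \<phi> n) \<longleftrightarrow>
      bij_betw \<phi> (adic_rationals n \<inter> {0<..<1}) (adic_rationals m \<inter> {0<..<1})"
    using closed_if_bij[OF assms(1-3) H] bij_if_closed[OF assms] by blast
  moreover have "bij_betw \<phi> (adic_rationals n \<inter> {0<..<1}) (adic_rationals m \<inter> {0<..<1}) \<longleftrightarrow>
      (\<exists>\<Phi>. is_lift n m \<phi> \<Phi> \<and> lex_preserving n \<Phi>)"
    using lift_exists_if_bij[OF assms(1-3)] bij_if_lift[OF assms(1-3)] by blast
  ultimately show ?thesis by blast
qed

end
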